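(* Let $\Upsilon$ be a tree. If the Banach space $\mathscr{C}_0(\Upsilon)$ admits a G\^{a}teaux smooth norm, then there exists an increasing function $\rho:\Upsilon\longrightarrow Z$ that has no $Z$-bad points and is not constant on any ever-branching subset of $\Upsilon$.
   Context: Trees. A tree is a partially ordered set $(\Upsilon,\preccurlyeq)$ such that for each $t\in\Upsilon$ the set of predecessors $(0,t]=\{s\in\Upsilon : s\preccurlyeq t\}$ is well-ordered; here $0$ is only a notational device, not an element of $\Upsilon$. The set of immediate successors of $t$ is denoted $t^+$. The interval topology on $\Upsilon$ is the coarsest topology for which all sets $(0,t]$, $t\in\Upsilon$, are both open and closed; it is scattered and locally compact. Throughout, all trees are assumed to have the property that every non-empty linearly ordered subset has at most one minimal upper bound, which makes the interval topology Hausdorff. $\mathscr{C}_0(\Upsilon)$ is the Banach space of continuous real-valued functions on $\Upsilon$ (with the interval topology) vanishing at infinity, with canonical norm the supremum norm. Norms. A norm on a Banach space $X$ always means a norm equivalent to the canonical one. A norm $\|\cdot\|$ is G\^{a}teaux smooth if for every $x\in X\setminus\{0\}$ there is a functional $\|x\|'\in X^*$ with $\lim_{\lambda\to 0}\frac{\|x+\lambda h\|-\|x\|}{\lambda}=\|x\|'(h)$ for all $h\in X$. Increasing maps. A map $\rho:P\to Q$ between partial orders is increasing if $\rho(s)\preccurlyeq\rho(t)$ whenever $s\prec t$. The order $Z$. Let $\omega_1$ be the first uncountable ordinal. $Z$ is the set of all increasing (i.e. non-decreasing), continuous transfinite sequences $x=(x_\xi)_{\xi\leq\beta}$ of real numbers,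 where $0\leq\beta<\omega_1$, such that $x$ is strictly increasing on $[0,\beta)$. It is linearly ordered by: $x<y$ if and only if either $y$ strictly extends $x$, or there is an ordinal $\alpha$ such that $x_\xi=y_\xi$ for $\xi<\alpha$ and $y_\alpha<x_\alpha$. $Z$-bad points. Given an increasing $\rho:\Upsilon\to Z$, a point $t\in\Upsilon$ is $Z$-bad for $\rho$ if there is a sequence of distinct points $(u_n)\subseteq t^+$ such that $\rho(u_n)\to\rho(t)$ in the order topology of $Z$. Ever-branching. A (non-empty) subset $E$ of a tree is ever-branching if each element of $E$ has a pair of strict successors in $E$ that are incomparable in the tree order. *)

theory Defs
  imports "HOL-Analysis.Analysis" "HOL-Library.Countable_Set_Type"
begin

text \<open>
  The type \<open>cord\<close> has order type \<open>\<omega>\<^sub>1\<close>, the cardinal successor of \<open>\<omega>\<close>: its elements are the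
  ordinals below \<open>\<omega>\<^sub>1\<close>. See \<open>countable_atMost_cord\<close> and \<open>uncountable_UNIV_cord\<close>.
\<close>

typedef cord = "Field (cardSuc natLeq)"
proof -
  have "\<not> finite (Field (cardSuc natLeq))"
    using cardSuc_finite[OF natLeq_Card_order] by (simp add: Field_natLeq)
  then show ?thesis by (metis ex_in_conv finite.emptyI)
qed

lemma Well_order_cardSuc_natLeq: "Well_order (cardSuc natLeq)"
  using cardSuc_Card_order[OF natLeq_Card_order] card_order_on_well_order_on by blast

instantiation cord :: linorder
begin

definition less_eq_cord :: "cord \<Rightarrow> cord \<Rightarrow> bool"
  where "a \<le> b \<longleftrightarrow> (Rep_cord a, Rep_cord b) \<in> cardSuc natLeq"

definition less_cord :: "cord \<Rightarrow> cord \<Rightarrow> bool"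
  where "a < b \<longleftrightarrow> a \<le> b \<and> a \<noteq> b" for a b :: cord

instance
proof
  note W = Well_order_cardSuc_natLeq
  have refl: "(Rep_cord a, Rep_cord a) \<in> cardSuc natLeq" for a
    using W Rep_cord[of a] unfolding order_on_defs refl_on_def by blast
  have antisym: "a = b" if "a \<le> b" "b \<le> a" for a b :: cord
    using W that Rep_cord_inject[of a b]
    unfolding order_on_defs antisym_def less_eq_cord_def by blast
  fix a b c :: cord
  show "a < b \<longleftrightarrow> a \<le> b \<and> \<not> b \<le> a"
    using antisym refl unfolding less_cord_def by (auto simp: less_eq_cord_def)
  show "a \<le> a" using refl by (simp add: less_eq_cord_def)
  show "a \<le> c" if "a \<le> b" "b \<le> c"
    using W that unfolding order_on_defs less_eq_cord_def by (meson transD)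
  show "a = b" if "a \<le> b" "b \<le> a" using antisym that by blast
  show "a \<le> b \<or> b \<le> a"
    using W Rep_cord[of a] Rep_cord[of b] refl[of a]
    unfolding order_on_defs total_on_def less_eq_cord_def by metis
qed

end

instance cord :: wellorder
proof
  fix P :: "cord \<Rightarrow> bool" and a :: cord
  assume step: "\<And>x. (\<And>y. y < x \<Longrightarrow> P y) \<Longrightarrow> P x"
  have "{(x, y). x < y} \<subseteq> inv_image (cardSuc natLeq - Id) Rep_cord"
    by (auto simp: less_cord_def less_eq_cord_def inv_image_def Rep_cord_inject)
  moreover have "wf (cardSuc natLeq - Id)"
    using Well_order_cardSuc_natLeq unfolding well_order_on_def by blast
  ultimately have "wf {(x, y :: cord). x < y}"
    by (rule wf_subset[OF wf_inv_image, rotated])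
  then show "P a"
  proof (induction a rule: wf_induct_rule)
    case (less x)
    show ?case by (rule step, rule less.IH) simp
  qed
qed

instantiation cord :: linorder_topology
begin

definition open_cord :: "cord set \<Rightarrow> bool"
  where "open_cord = generate_topology (range (\<lambda>a. {..<a}) \<union> range (\<lambda>a. {a<..}))"

instance by standard (rule open_cord_def)

end

lemma countable_atMost_cord:
  includes cardinal_syntax
  shows "countable {..a :: cord}"
proof -
  let ?r = "cardSuc natLeq"
  have "|underS ?r (Rep_cord a)| <o ?r"
    using card_of_underS[OF cardSuc_Card_order[OF natLeq_Card_order]] Rep_cord by blast
  then have "|underS ?r (Rep_cord a)| \<le>o natLeq"
    using cardSuc_ordLeq_ordLess[OF natLeq_Card_order card_of_Card_order] by blast
  then have "countable (underS ?r (Rep_cord a))"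
    using countable_card_le_natLeq by blast
  moreover have "Rep_cord ` {..<a} \<subseteq> underS ?r (Rep_cord a)"
    by (auto simp: underS_def less_cord_def less_eq_cord_def Rep_cord_inject)
  ultimately have "countable (Rep_cord ` {..<a})"
    using countable_subset by blast
  then have "countable {..<a}"
    by (rule countable_image_inj_on) (simp add: inj_on_def Rep_cord_inject)
  moreover have "{..a} = insert a {..<a}" by auto
  ultimately show ?thesis by simp
qed

lemma uncountable_UNIV_cord:
  includes cardinal_syntax
  shows "uncountable (UNIV :: cord set)"
proof
  assume "countable (UNIV :: cord set)"
  then have "countable (range Rep_cord)" by simp
  then have "countable (Field (cardSuc natLeq))"
    using type_definition.Rep_range[OF type_definition_cord] by simp
  then have "|Field (cardSuc natLeq)| \<le>o natLeq"
    using countable_card_le_natLeq by blast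
  then have "cardSuc natLeq \<le>o natLeq"
    using card_of_Field_ordIso[OF cardSuc_Card_order[OF natLeq_Card_order]]
      ordIso_ordLeq_trans ordIso_symmetric by blast
  then show False
    using cardSuc_greater[OF natLeq_Card_order] not_ordLess_ordLeq by blast
qed

text \<open>
  A transfinite sequence \<open>(x\<^sub>\<xi>)\<close>, \<open>\<xi> \<le> \<beta>\<close>, is a partial function with domain \<open>{..\<beta>}\<close>.
  Since \<open>{..\<beta>}\<close> is an initial segment, its subspace topology is its own order topology.
\<close>

typedef Z = "{x :: cord \<rightharpoonup> real. \<exists>\<beta>. dom x = {..\<beta>} \<and> mono_on {..\<beta>} (the \<circ> x) \<and>
    continuous_on {..\<beta>} (the \<circ> x) \<and> strict_mono_on {..<\<beta>} (the \<circ> x)}"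
proof -
  define b :: cord where "b = (LEAST b. True)"
  have b: "b \<le> c" for c unfolding b_def by (simp add: Least_le)
  then have 1: "{..b} = {b}" by (auto intro: antisym)
  have 2: "{..<b} = {}" using b leD by blast
  show ?thesis
    by (rule exI[of _ "[b \<mapsto> 0]"], simp, rule exI[of _ b])
      (simp add: 1 2 mono_on_def strict_mono_on_def)
qed

instantiation Z :: linorder
begin

definition less_Z :: "Z \<Rightarrow> Z \<Rightarrow> bool"
  where "x < y \<longleftrightarrow>
    Rep_Z x \<subseteq>\<^sub>m Rep_Z y \<and> Rep_Z x \<noteq> Rep_Z y \<or>
    (\<exists>\<alpha> \<in> dom (Rep_Z x) \<inter> dom (Rep_Z y).
      (\<forall>\<xi><\<alpha>. Rep_Z x \<xi> = Rep_Z y \<xi>) \<and> the (Rep_Z y \<alpha>) < the (Rep_Z x \<alpha>))"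

definition less_eq_Z :: "Z \<Rightarrow> Z \<Rightarrow> bool"
  where "x \<le> y \<longleftrightarrow> x < y \<or> x = y" for x y :: Z

instance
proof
  have dom: "\<exists>\<beta>. dom (Rep_Z x) = {..\<beta>}" for x using Rep_Z[of x] by blast
  have down: "\<xi> \<in> dom (Rep_Z x)" if "\<alpha> \<in> dom (Rep_Z x)" "\<xi> \<le> \<alpha>" for x \<xi> \<alpha>
    using dom[of x] that by (metis atMost_iff order_trans)
  \<comment> \<open>both cases of the definition are a lexicographic comparison at the first difference\<close>
  define R where "R u v \<longleftrightarrow> (case (u, v) of (None, Some _) \<Rightarrow> True
      | (Some r, Some s) \<Rightarrow> s < r | _ \<Rightarrow> False)" for u v :: "real option"
  have R_irrefl: "\<not> R u u" for u by (auto simp: R_def split: option.splits)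
  have R_trans: "R u w" if "R u v" "R v w" for u v w
    using that by (auto simp: R_def split: option.splits)
  have R_total: "u = v \<or> R u v \<or> R v u" for u v
    by (auto simp: R_def split: option.splits)
  have lex: "x < y \<longleftrightarrow>
      (\<exists>\<alpha>. (\<forall>\<xi><\<alpha>. Rep_Z x \<xi> = Rep_Z y \<xi>) \<and> R (Rep_Z x \<alpha>) (Rep_Z y \<alpha>))" for x y
  proof
    assume "x < y"
    then consider (ext) "Rep_Z x \<subseteq>\<^sub>m Rep_Z y" "Rep_Z x \<noteq> Rep_Z y"
      | (diff) \<alpha> where "\<alpha> \<in> dom (Rep_Z x) \<inter> dom (Rep_Z y)"
          "\<forall>\<xi><\<alpha>. Rep_Z x \<xi> = Rep_Z y \<xi>" "the (Rep_Z y \<alpha>) < the (Rep_Z x \<alpha>)"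
      unfolding less_Z_def by blast
    then show "\<exists>\<alpha>. (\<forall>\<xi><\<alpha>. Rep_Z x \<xi> = Rep_Z y \<xi>) \<and> R (Rep_Z x \<alpha>) (Rep_Z y \<alpha>)"
    proof cases
      case ext
      define \<alpha> where "\<alpha> = (LEAST \<alpha>. Rep_Z x \<alpha> \<noteq> Rep_Z y \<alpha>)"
      have ne: "Rep_Z x \<alpha> \<noteq> Rep_Z y \<alpha>"
        unfolding \<alpha>_def using ext(2) LeastI_ex[of "\<lambda>\<alpha>. Rep_Z x \<alpha> \<noteq> Rep_Z y \<alpha>"]
        by (auto simp: fun_eq_iff)
      moreover have "\<forall>\<xi><\<alpha>. Rep_Z x \<xi> = Rep_Z y \<xi>"
        unfolding \<alpha>_def using not_less_Least by blast
      moreover have "Rep_Z x \<alpha> = None"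
        using ne ext(1) unfolding map_le_def by (auto simp: domIff)
      ultimately show ?thesis
        by (intro exI[of _ \<alpha>]) (auto simp: R_def split: option.splits)
    next
      case diff
      then show ?thesis by (intro exI[of _ \<alpha>]) (auto simp: R_def)
    qed
  next
    assume "\<exists>\<alpha>. (\<forall>\<xi><\<alpha>. Rep_Z x \<xi> = Rep_Z y \<xi>) \<and> R (Rep_Z x \<alpha>) (Rep_Z y \<alpha>)"
    then obtain \<alpha> where eq: "\<forall>\<xi><\<alpha>. Rep_Z x \<xi> = Rep_Z y \<xi>"
      and R: "R (Rep_Z x \<alpha>) (Rep_Z y \<alpha>)" by blast
    show "x < y"
    proof (cases "Rep_Z x \<alpha>")
      case None
      have "Rep_Z x \<subseteq>\<^sub>m Rep_Z y"
        unfolding map_le_def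
      proof
        fix \<xi> assume "\<xi> \<in> dom (Rep_Z x)"
        then have "\<xi> < \<alpha>" using None down[of \<xi> x \<alpha>] by (metis domIff not_less)
        then show "Rep_Z x \<xi> = Rep_Z y \<xi>" using eq by blast
      qed
      moreover have "Rep_Z x \<noteq> Rep_Z y" using R R_irrefl by metis
      ultimately show ?thesis unfolding less_Z_def by blast
    next
      case (Some r)
      then obtain s where "Rep_Z y \<alpha> = Some s" "s < r"
        using R by (auto simp: R_def split: option.splits)
      with Some eq show ?thesis
        unfolding less_Z_def by (intro disjI2 bexI[of _ \<alpha>]) auto
    qed
  qed
  have irrefl: "\<not> x < x" for x :: Z unfolding lex using R_irrefl by blast
  have trans: "x < z" if xy: "x < y" and yz: "y < z" for x y z :: Z
  proof -
    obtain \<alpha> where \<alpha>: "\<forall>\<xi><\<alpha>. Rep_Z x \<xi> = Rep_Z y \<xi>" "R (Rep_Z x \<alpha>) (Rep_Z y \<alpha>)"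
      using iffD1[OF lex xy] by blast
    obtain \<gamma> where \<gamma>: "\<forall>\<xi><\<gamma>. Rep_Z y \<xi> = Rep_Z z \<xi>" "R (Rep_Z y \<gamma>) (Rep_Z z \<gamma>)"
      using iffD1[OF lex yz] by blast
    have "\<forall>\<xi> < min \<alpha> \<gamma>. Rep_Z x \<xi> = Rep_Z z \<xi>" using \<alpha> \<gamma> by simp
    moreover have "R (Rep_Z x (min \<alpha> \<gamma>)) (Rep_Z z (min \<alpha> \<gamma>))"
    proof (cases \<alpha> \<gamma> rule: linorder_cases)
      case less
      then show ?thesis using \<alpha>(2) \<gamma>(1) by (simp add: min_absorb1)
    next
      case equal
      then show ?thesis using R_trans[OF \<alpha>(2)] \<gamma>(2) by simp
    next
      case greater
      then show ?thesis using \<alpha>(1) \<gamma>(2) by (simp add: min_absorb2)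
    qed
    ultimately show ?thesis unfolding lex by blast
  qed
  have total: "x < y \<or> x = y \<or> y < x" for x y :: Z
  proof (cases "Rep_Z x = Rep_Z y")
    case True
    then show ?thesis by (simp add: Rep_Z_inject)
  next
    case False
    define \<alpha> where "\<alpha> = (LEAST \<alpha>. Rep_Z x \<alpha> \<noteq> Rep_Z y \<alpha>)"
    have "Rep_Z x \<alpha> \<noteq> Rep_Z y \<alpha>"
      unfolding \<alpha>_def using False LeastI_ex[of "\<lambda>\<alpha>. Rep_Z x \<alpha> \<noteq> Rep_Z y \<alpha>"]
      by (auto simp: fun_eq_iff)
    then consider "R (Rep_Z x \<alpha>) (Rep_Z y \<alpha>)" | "R (Rep_Z y \<alpha>) (Rep_Z x \<alpha>)"
      using R_total by blast
    moreover have eq: "\<forall>\<xi><\<alpha>. Rep_Z x \<xi> = Rep_Z y \<xi>"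
      unfolding \<alpha>_def using not_less_Least by blast
    moreover have "\<forall>\<xi><\<alpha>. Rep_Z y \<xi> = Rep_Z x \<xi>" using eq by simp
    ultimately show ?thesis using lex by cases blast+
  qed
  fix x y z :: Z
  show "x < y \<longleftrightarrow> x \<le> y \<and> \<not> y \<le> x"
    unfolding less_eq_Z_def using irrefl[of x] trans[of x y] by auto
  show "x \<le> x" by (simp add: less_eq_Z_def)
  show "x \<le> z" if "x \<le> y" "y \<le> z" using that trans[of x y z] unfolding less_eq_Z_def by auto
  show "x = y" if "x \<le> y" "y \<le> x" using that trans[of x y x] irrefl[of x] unfolding less_eq_Z_def by auto
  show "x \<le> y \<or> y \<le> x" using total[of x y] unfolding less_eq_Z_def by auto
qed

end

instantiation Z :: linorder_topology
begin

definition open_Z :: "Z set \<Rightarrow> bool"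
  where "open_Z = generate_topology (range (\<lambda>a. {..<a}) \<union> range (\<lambda>a. {a<..}))"

instance by standard (rule open_Z_def)

end

text \<open>
  A tree is given by its underlying set \<open>T\<close> and its reflexive order \<open>r \<subseteq> T \<times> T\<close>;
  then \<open>Order_Relation.under r t\<close> is the set \<open>(0,t]\<close>.
\<close>

definition minimal_upper_bound :: "'a set \<Rightarrow> 'a rel \<Rightarrow> 'a set \<Rightarrow> 'a \<Rightarrow> bool"
  where "minimal_upper_bound T r C u \<longleftrightarrow>
    u \<in> T \<and> (\<forall>c\<in>C. (c, u) \<in> r) \<and>
    (\<forall>v\<in>T. (\<forall>c\<in>C. (c, v) \<in> r) \<and> (v, u) \<in> r \<longrightarrow> v = u)"

definition tree :: "'a set \<Rightarrow> 'a rel \<Rightarrow> bool"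
  where "tree T r \<longleftrightarrow>
    partial_order_on T r \<and>
    (\<forall>t\<in>T. well_order_on (Order_Relation.under r t) (Restr r (Order_Relation.under r t))) \<and>
    (\<forall>C u v. C \<subseteq> T \<and> C \<noteq> {} \<and> C \<in> Chains r \<and>
      minimal_upper_bound T r C u \<and> minimal_upper_bound T r C v \<longrightarrow> u = v)"

definition tree_less :: "'a rel \<Rightarrow> 'a \<Rightarrow> 'a \<Rightarrow> bool"
  where "tree_less r s t \<longleftrightarrow> (s, t) \<in> r \<and> s \<noteq> t"

definition immediate_successors :: "'a set \<Rightarrow> 'a rel \<Rightarrow> 'a \<Rightarrow> 'a set"
  where "immediate_successors T r t =
    {u \<in> T. tree_less r t u \<and> \<not> (\<exists>v\<in>T. tree_less r t v \<and> tree_less r v u)}"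

definition ever_branching :: "'a set \<Rightarrow> 'a rel \<Rightarrow> 'a set \<Rightarrow> bool"
  where "ever_branching T r E \<longleftrightarrow>
    E \<subseteq> T \<and> E \<noteq> {} \<and>
    (\<forall>t\<in>E. \<exists>u\<in>E. \<exists>v\<in>E. tree_less r t u \<and> tree_less r t v \<and> (u, v) \<notin> r \<and> (v, u) \<notin> r)"

definition interval_topology :: "'a set \<Rightarrow> 'a rel \<Rightarrow> 'a topology"
  where "interval_topology T r =
    topology_generated_by ((\<Union>t\<in>T. {Order_Relation.under r t, T - Order_Relation.under r t}))"

lemma topspace_interval_topology:
  assumes "partial_order_on T r"
  shows "topspace (interval_topology T r) = T"
proof -
  have "r \<subseteq> T \<times> T" and "refl_on T r"
    using assms unfolding partial_order_on_def preorder_on_def by auto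
  then show ?thesis
    unfolding interval_topology_def
    by (auto simp: topology_generated_by_topspace Order_Relation.under_def refl_on_def)
qed

text \<open>Functions on the space \<open>X\<close> are extended by zero outside of \<open>topspace X\<close>.\<close>

definition C0 :: "'a topology \<Rightarrow> ('a \<Rightarrow> real) set"
  where "C0 X = {f. continuous_map X euclideanreal f \<and>
    (\<forall>\<epsilon>>0. \<exists>K. compactin X K \<and> (\<forall>t \<in> topspace X - K. \<bar>f t\<bar> < \<epsilon>)) \<and>
    (\<forall>t. t \<notin> topspace X \<longrightarrow> f t = 0)}"

text \<open>On \<open>C0 X\<close> this is the supremum over \<open>topspace X\<close>, and \<open>0\<close> if that is empty.\<close>

definition sup_norm :: "('a \<Rightarrow> real) \<Rightarrow> real"
  where "sup_norm f = (SUP t. \<bar>f t\<bar>)"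

definition equivalent_norm_on :: "('a \<Rightarrow> real) set \<Rightarrow> (('a \<Rightarrow> real) \<Rightarrow> real) \<Rightarrow> bool"
  where "equivalent_norm_on V N \<longleftrightarrow>
    (\<forall>f\<in>V. N f = 0 \<longleftrightarrow> f = (\<lambda>t. 0)) \<and>
    (\<forall>f\<in>V. \<forall>c. N (\<lambda>t. c * f t) = \<bar>c\<bar> * N f) \<and>
    (\<forall>f\<in>V. \<forall>g\<in>V. N (\<lambda>t. f t + g t) \<le> N f + N g) \<and>
    (\<exists>a>0. \<exists>b>0. \<forall>f\<in>V. a * sup_norm f \<le> N f \<and> N f \<le> b * sup_norm f)"

definition dual_functional_on :: "('a \<Rightarrow> real) set \<Rightarrow> (('a \<Rightarrow> real) \<Rightarrow> real) \<Rightarrow> bool"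
  where "dual_functional_on V L \<longleftrightarrow>
    (\<forall>f\<in>V. \<forall>c. L (\<lambda>t. c * f t) = c * L f) \<and>
    (\<forall>f\<in>V. \<forall>g\<in>V. L (\<lambda>t. f t + g t) = L f + L g) \<and>
    (\<exists>b. \<forall>f\<in>V. \<bar>L f\<bar> \<le> b * sup_norm f)"

definition Gateaux_smooth_on :: "('a \<Rightarrow> real) set \<Rightarrow> (('a \<Rightarrow> real) \<Rightarrow> real) \<Rightarrow> bool"
  where "Gateaux_smooth_on V N \<longleftrightarrow>
    (\<forall>f\<in>V. f \<noteq> (\<lambda>t. 0) \<longrightarrow>
      (\<exists>L. dual_functional_on V L \<and>
        (\<forall>h\<in>V. ((\<lambda>c. (N (\<lambda>t. f t + c * h t) - N f) / c) \<longlongrightarrow> L h) (at 0))))"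

definition increasing_on :: "'a set \<Rightarrow> 'a rel \<Rightarrow> ('a \<Rightarrow> Z) \<Rightarrow> bool"
  where "increasing_on T r \<rho> \<longleftrightarrow> monotone_on T (tree_less r) (\<le>) \<rho>"

definition Z_bad :: "'a set \<Rightarrow> 'a rel \<Rightarrow> ('a \<Rightarrow> Z) \<Rightarrow> 'a \<Rightarrow> bool"
  where "Z_bad T r \<rho> t \<longleftrightarrow>
    (\<exists>u :: nat \<Rightarrow> 'a. inj u \<and> range u \<subseteq> immediate_successors T r t \<and>
      (\<lambda>n. \<rho> (u n)) \<longlonglongrightarrow> \<rho> t)"

end

theory Submission
  imports Defs
begin

text \<open>
  Let \<open>N\<close> be an equivalent norm with \<open>a * sup_norm f \<le> N f \<le> b * sup_norm f\<close>. Along the branch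
  \<open>(0,t]\<close> one tries to build a function that climbs as high as possible at a limited cost. A
  staircase on \<open>(0,t]\<close> with top value \<open>l\<close> is affordable if it extends, with values that vanish at
  the points incomparable to \<open>t\<close>, to functions of norm arbitrarily close to \<open>1 + a/2 * l\<close>. As
  \<open>a/2 < a\<close>, the affordable heights are bounded by \<open>2/a\<close>. The levels \<open>lev \<xi> t\<close> are defined by recursion
  on \<open>\<xi>\<close>. At a successor stage (or at stage \<open>0\<close>) the staircase keeps its values up to the first point
  \<open>s\<close> of the branch whose previous levels are all equal to those of \<open>t\<close>, and \<open>lev \<xi> t\<close> is the greatest
  affordable height to which it can be raised on the remaining segment \<open>(s,t]\<close> (on all of \<open>(0,t]\<close> at
  stage \<open>0\<close>), or the conventional value \<open>2/a + 1\<close> if \<open>s = t\<close>; at limit stages one takes suprema.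
  A larger \<open>t\<close> imposes more constraints, so the first level in which two comparable points differ is
  smaller at the larger point (\<open>lev_antimono\<close>); this is exactly the order of \<open>Z\<close>.
  The levels cannot increase strictly through all countable ordinals, and \<open>rho t\<close> is the sequence of
  levels up to the first repetition, including the repeated value. It is increasing by
  \<open>lev_antimono\<close>.

  Differentiability of the norm enters through \<open>not_attained\<close>. Let \<open>lev (csuc \<beta>) t = lev \<beta> t \<le> 2/a\<close>,
  let \<open>s\<close> be the first point with the levels of \<open>t\<close> up to \<open>\<beta>\<close>, and suppose that the staircase of \<open>t\<close>
  has an extension \<open>f\<close> whose norm is exactly \<open>1 + a/2 * lev \<beta> t\<close>. This is the infimum of the norms of
  the extensions of the staircase of \<open>s\<close> (\<open>lev_optimal\<close>), and changing \<open>f\<close> on the segment \<open>(s,t]\<close>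
  yields other extensions of the staircase of \<open>s\<close>. So the derivative of the norm at \<open>f\<close> in the
  direction of the indicator of \<open>(s,t]\<close> is zero, hence raising \<open>f\<close> a little there costs less than
  slope \<open>a/2\<close>, contrary to the maximality of \<open>lev (csuc \<beta>) t\<close>. Hence the infimum is never attained at
  the stage where \<open>rho t\<close> stops, unless the last level is \<open>2/a + 1\<close>.

  A bad point or an ever-branching set on which \<open>rho\<close> is constant makes it attained, by averaging,
  and the exceptional last level does not occur there. At a bad point \<open>t\<close> one averages
  nearly optimal extensions for many immediate successors of \<open>t\<close>; above
  \<open>t\<close> they have disjoint supports, so the averages converge in norm to the staircase of \<open>t\<close>,
  extended by zero (\<open>average_near\<close>). In an ever-branching set one replaces, again and again, the function
  chosen for \<open>t\<close> by the average of those chosen for two incomparable successors of \<open>t\<close>; each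
  time the distances between two such families of functions are halved, so the procedure converges,
  and to a limit that does not depend on how nearly optimal the initial functions were
  (\<open>not_constant_on_ever_branching\<close>).
\<close>

section \<open>Countable ordinals\<close>

lemma cord_no_greatest: "\<exists>b. a < (b :: cord)"
proof (rule ccontr)
  assume "\<not> (\<exists>b. a < b)"
  then have "UNIV = {..a}" by (auto simp: not_less)
  then show False using countable_atMost_cord[of a] uncountable_UNIV_cord by simp
qed

text \<open>The successor ordinal.\<close>

definition csuc :: "cord \<Rightarrow> cord"
  where "csuc a = (LEAST b. a < b)"

lemma less_csuc: "a < csuc a"
  unfolding csuc_def using cord_no_greatest by (rule LeastI_ex)

lemma csuc_le_iff: "csuc a \<le> b \<longleftrightarrow> a < b"
  using less_csuc[of a] Least_le[of "\<lambda>b. a < b" b] unfolding csuc_def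
  by (auto intro: less_le_trans)

lemma less_csuc_iff: "b < csuc a \<longleftrightarrow> b \<le> a"
  using csuc_le_iff[of a b] by (metis not_le)

text \<open>Non-zero limit ordinals.\<close>

definition is_limit :: "cord \<Rightarrow> bool"
  where "is_limit \<xi> \<longleftrightarrow> (\<exists>\<eta>. \<eta> < \<xi>) \<and> (\<forall>\<eta><\<xi>. csuc \<eta> < \<xi>)"

lemma cord_cases:
  obtains (zero) "\<And>\<eta>. \<not> \<eta> < \<xi>" | (suc) \<eta> where "\<xi> = csuc \<eta>" | (limit) "is_limit \<xi>"
proof -
  show ?thesis
  proof (cases "is_limit \<xi> \<or> (\<forall>\<eta>. \<not> \<eta> < \<xi>)")
    case True
    then show ?thesis using zero limit by blast
  next
    case False
    then obtain \<eta> where "\<eta> < \<xi>" "\<not> csuc \<eta> < \<xi>" unfolding is_limit_def by blast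
    then have "\<xi> = csuc \<eta>" using csuc_le_iff[of \<eta> \<xi>] by auto
    then show ?thesis by (rule suc)
  qed
qed

lemma not_is_limit_csuc: "\<not> is_limit (csuc \<eta>)"
  unfolding is_limit_def using less_csuc by blast

text \<open>
  A monotone real sequence on an initial segment of the ordinals can only be discontinuous at limit
  ordinals, from the left.
\<close>

lemma continuous_on_mono_cord:
  fixes f :: "cord \<Rightarrow> real"
  assumes mono: "mono_on {..\<beta>} f"
    and lim: "\<And>\<xi> e. \<xi> \<le> \<beta> \<Longrightarrow> is_limit \<xi> \<Longrightarrow> 0 < e \<Longrightarrow> \<exists>\<eta><\<xi>. f \<xi> - e < f \<eta>"
  shows "continuous_on {..\<beta>} f"
  unfolding continuous_on_def
proof (intro ballI tendstoI)
  fix \<xi> and e :: real assume \<xi>: "\<xi> \<in> {..\<beta>}" and e: "0 < e"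
  have nbhd: "\<exists>S. open S \<and> \<xi> \<in> S \<and> (\<forall>\<zeta>\<in>S. \<zeta> \<noteq> \<xi> \<longrightarrow> \<zeta> \<in> {..\<beta>} \<longrightarrow> dist (f \<zeta>) (f \<xi>) < e)"
  proof (cases \<xi> rule: cord_cases)
    case zero
    then have "\<zeta> = \<xi>" if "\<zeta> \<le> \<xi>" for \<zeta> using that by (simp add: order_less_le)
    then show ?thesis
      by (intro exI[of _ "{..<csuc \<xi>}"]) (auto simp: less_csuc less_csuc_iff)
  next
    case (suc \<eta>)
    have "\<zeta> = \<xi>" if "\<eta> < \<zeta>" "\<zeta> < csuc \<xi>" for \<zeta>
      using that suc csuc_le_iff[of \<eta> \<zeta>] by (auto simp: less_csuc_iff)
    then show ?thesis
      by (intro exI[of _ "{\<eta><..<csuc \<xi>}"]) (use suc less_csuc in auto)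
  next
    case limit
    then obtain \<eta> where \<eta>: "\<eta> < \<xi>" "f \<xi> - e < f \<eta>" using lim[of \<xi> e] \<xi> e by auto
    have "dist (f \<zeta>) (f \<xi>) < e" if "\<eta> < \<zeta>" "\<zeta> < csuc \<xi>" for \<zeta>
    proof -
      have "\<zeta> \<le> \<xi>" using that by (simp add: less_csuc_iff)
      then have "f \<zeta> \<le> f \<xi>" "f \<eta> \<le> f \<zeta>"
        using mono_onD[OF mono, of \<zeta> \<xi>] mono_onD[OF mono, of \<eta> \<zeta>] \<xi> that \<eta> by auto
      then show ?thesis using \<eta> by (simp add: dist_real_def)
    qed
    then show ?thesis
      using \<eta> less_csuc by (intro exI[of _ "{\<eta><..<csuc \<xi>}"]) auto
  qed
  show "\<forall>\<^sub>F \<zeta> in at \<xi> within {..\<beta>}. dist (f \<zeta>) (f \<xi>) < e"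
    unfolding eventually_at_topological using nbhd by blast
qed

lemma cord_real_mono_stationary:
  fixes f :: "cord \<Rightarrow> real"
  assumes "\<And>\<eta> \<xi>. \<eta> < \<xi> \<Longrightarrow> f \<eta> \<le> f \<xi>"
  shows "\<exists>\<xi>. f (csuc \<xi>) = f \<xi>"
proof (rule ccontr)
  assume ne: "\<not> (\<exists>\<xi>. f (csuc \<xi>) = f \<xi>)"
  \<comment> \<open>otherwise distinct rationals separate the uncountably many values\<close>
  have "\<exists>q::rat. f \<xi> < of_rat q \<and> of_rat q < f (csuc \<xi>)" for \<xi>
  proof -
    have "f \<xi> < f (csuc \<xi>)" using ne assms[OF less_csuc, of \<xi>] by (simp add: order_less_le) metis
    then show ?thesis using of_rat_dense by blast
  qed
  then obtain q :: "cord \<Rightarrow> rat" where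
    q: "\<And>\<xi>. f \<xi> < of_rat (q \<xi>)" "\<And>\<xi>. of_rat (q \<xi>) < f (csuc \<xi>)" by metis
  have "of_rat (q \<eta>) < (of_rat (q \<xi>) :: real)" if "\<eta> < \<xi>" for \<eta> \<xi>
  proof -
    have "f (csuc \<eta>) \<le> f \<xi>"
      using that assms[of "csuc \<eta>" \<xi>] csuc_le_iff[of \<eta> \<xi>] by (cases "csuc \<eta> = \<xi>") auto
    then show ?thesis using q(2)[of \<eta>] q(1)[of \<xi>] by linarith
  qed
  then have less: "q \<eta> < q \<xi>" if "\<eta> < \<xi>" for \<eta> \<xi> using that by (simp add: of_rat_less)
  have "inj q"
  proof (rule injI)
    fix \<eta> \<xi> assume "q \<eta> = q \<xi>"
    then show "\<eta> = \<xi>" using less[of \<eta> \<xi>] less[of \<xi> \<eta>] by (cases \<eta> \<xi> rule: linorder_cases) auto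
  qed
  then have "countable (UNIV :: cord set)"
    using countable_image_inj_on[of q UNIV] countableI_type by blast
  then show False using uncountable_UNIV_cord by simp
qed

section \<open>The interval topology\<close>

text \<open>
  A tree with order \<open>\<sqsubseteq>\<close>, strict order \<open>\<sqsubset>\<close> and interval topology \<open>X\<close>; \<open>I t\<close> is the segment \<open>(0,t]\<close>.
\<close>

locale interval_tree =
  fixes T :: "'a set" and r :: "'a rel"
  assumes tree: "tree T r"
begin

abbreviation le (infix "\<sqsubseteq>" 50) where "s \<sqsubseteq> t \<equiv> (s, t) \<in> r"
abbreviation lt (infix "\<sqsubset>" 50) where "s \<sqsubset> t \<equiv> tree_less r s t"
abbreviation I :: "'a \<Rightarrow> 'a set" where "I \<equiv> Order_Relation.under r"
abbreviation X where "X \<equiv> interval_topology T r"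

lemma po: "partial_order_on T r" using tree unfolding tree_def by blast

lemma in_T: "s \<sqsubseteq> t \<Longrightarrow> s \<in> T" "s \<sqsubseteq> t \<Longrightarrow> t \<in> T"
  using po unfolding partial_order_on_def preorder_on_def by auto

lemma le_refl: "t \<in> T \<Longrightarrow> t \<sqsubseteq> t"
  using po unfolding partial_order_on_def preorder_on_def refl_on_def by auto

lemma le_trans: "s \<sqsubseteq> t \<Longrightarrow> t \<sqsubseteq> u \<Longrightarrow> s \<sqsubseteq> u"
  using po unfolding partial_order_on_def preorder_on_def trans_def by blast

lemma le_antisym: "s \<sqsubseteq> t \<Longrightarrow> t \<sqsubseteq> s \<Longrightarrow> s = t"
  using po unfolding partial_order_on_def antisym_def by blast

lemma lt_le: "s \<sqsubset> t \<Longrightarrow> s \<sqsubseteq> t" unfolding tree_less_def by simp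

lemma lt_le_trans: "s \<sqsubset> t \<Longrightarrow> t \<sqsubseteq> u \<Longrightarrow> s \<sqsubset> u"
  unfolding tree_less_def using le_trans le_antisym by blast

lemma not_lt_le: "s \<sqsubset> t \<Longrightarrow> \<not> t \<sqsubseteq> s"
  unfolding tree_less_def using le_antisym by blast

lemma mem_I: "v \<in> I t \<longleftrightarrow> v \<sqsubseteq> t"
  unfolding Order_Relation.under_def by simp

lemma wo: "t \<in> T \<Longrightarrow> well_order_on (I t) (Restr r (I t))"
  using tree unfolding tree_def by blast

lemma le_linear: assumes "s \<sqsubseteq> u" "t \<sqsubseteq> u" shows "s \<sqsubseteq> t \<or> t \<sqsubset> s"
proof (cases "s = t")
  case True
  then show ?thesis using assms in_T le_refl by blast
next
  case False
  have "total_on (I u) (Restr r (I u))"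
    using wo[of u] in_T assms unfolding well_order_on_def linear_order_on_def by blast
  then show ?thesis using False assms unfolding total_on_def tree_less_def
    by (auto simp: mem_I)
qed

lemma tree_least:
  assumes t: "t \<in> T" and A: "A \<subseteq> I t" "A \<noteq> {}"
  obtains m where "m \<in> A" "\<And>v. v \<in> A \<Longrightarrow> m \<sqsubseteq> v"
proof -
  have "wf (Restr r (I t) - Id)" using wo[OF t] unfolding well_order_on_def by blast
  then obtain m where m: "m \<in> A" "\<And>v. (v, m) \<in> Restr r (I t) - Id \<Longrightarrow> v \<notin> A"
    using A wfE_min[of "Restr r (I t) - Id" _ A] by blast
  have "m \<sqsubseteq> v" if "v \<in> A" for v
  proof -
    have "v \<in> I t" "m \<in> I t" using that m A by auto
    then have "m \<sqsubseteq> v \<or> v \<sqsubset> m" using le_linear by (simp add: mem_I)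
    then show ?thesis
      using m(2)[of v] that \<open>v \<in> I t\<close> \<open>m \<in> I t\<close> unfolding tree_less_def by blast
  qed
  then show ?thesis using m that by blast
qed

lemma tree_induct [consumes 1, case_names less]:
  assumes t: "t \<in> T" and step: "\<And>t. t \<in> T \<Longrightarrow> (\<And>s. s \<sqsubset> t \<Longrightarrow> P s) \<Longrightarrow> P t"
  shows "P t"
proof (rule ccontr)
  assume "\<not> P t"
  then have ne: "{s \<in> I t. \<not> P s} \<noteq> {}" using le_refl[OF t] by (auto simp: mem_I)
  obtain m where m': "m \<in> {s \<in> I t. \<not> P s}" "\<And>v. v \<in> {s \<in> I t. \<not> P s} \<Longrightarrow> m \<sqsubseteq> v"
    by (rule tree_least[OF t _ ne]) auto
  then have m: "m \<in> I t" "\<not> P m" "\<And>v. v \<in> I t \<Longrightarrow> \<not> P v \<Longrightarrow> m \<sqsubseteq> v" by simp_all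
  have "P s" if "s \<sqsubset> m" for s
  proof (rule ccontr)
    assume "\<not> P s"
    moreover have "s \<in> I t" using lt_le[OF that] m(1) unfolding mem_I by (rule le_trans)
    ultimately show False using m(3) not_lt_le[OF that] by blast
  qed
  moreover have "m \<in> T" using m(1) in_T(1) unfolding mem_I by blast
  ultimately show False using step[of m] m(2) by blast
qed

lemma topspace_X: "topspace X = T" by (rule topspace_interval_topology[OF po])

lemma openin_I: "t \<in> T \<Longrightarrow> openin X (I t)" "t \<in> T \<Longrightarrow> openin X (T - I t)"
  unfolding interval_topology_def by (auto intro!: topology_generated_by_Basis)

lemma I_subset: "I t \<subseteq> T" using in_T(1) unfolding subset_iff mem_I by blast

lemma I_mono: "s \<sqsubseteq> t \<Longrightarrow> I s \<subseteq> I t" unfolding subset_iff mem_I using le_trans by blast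

text \<open>
  The intersection of two initial segments has a largest element if it is non-empty and proper:
  otherwise the first points of both segments outside of it were distinct minimal upper bounds.
\<close>

lemma I_Int_I_greatest:
  assumes t: "t \<in> T" and w: "w \<in> T" and ne: "I t \<inter> I w \<noteq> {}"
  obtains s where "s \<in> I t \<inter> I w" "I t \<inter> I w \<subseteq> I s"
proof (rule ccontr)
  let ?A = "I t \<inter> I w"
  assume "\<not> thesis"
  then have nomax: "\<And>s. s \<in> ?A \<Longrightarrow> \<not> ?A \<subseteq> I s" using that by blast
  have first: "\<exists>m \<in> I u - I u'. minimal_upper_bound T r ?A m"
    if u: "u \<in> T" and u': "u' \<in> T" and A: "?A = I u \<inter> I u'" for u u'
  proof -
    have "u \<notin> ?A" using nomax[of u] u u' A I_mono by auto
    then have ne: "I u - I u' \<noteq> {}" using le_refl[OF u] A by (auto simp: mem_I)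
    obtain m where m: "m \<in> I u - I u'" "\<And>v. v \<in> I u - I u' \<Longrightarrow> m \<sqsubseteq> v"
      by (rule tree_least[OF u _ ne]) auto
    have ub: "c \<sqsubseteq> m" if c: "c \<in> ?A" for c
    proof -
      have "c \<sqsubseteq> m \<or> m \<sqsubset> c" using le_linear[of c u m] c m A by (auto simp: mem_I)
      moreover have "\<not> m \<sqsubset> c" using c m A le_trans[of m c u'] lt_le[of m c] by (auto simp: mem_I)
      ultimately show ?thesis by blast
    qed
    have "v = m" if v: "\<forall>c\<in>?A. c \<sqsubseteq> v" "v \<sqsubseteq> m" for v
    proof -
      have "v \<in> I u" using v(2) m(1) le_trans[of v m u] by (auto simp: mem_I)
      show ?thesis
      proof (cases "v \<in> I u'")
        case True
        then have "v \<in> ?A" using A \<open>v \<in> I u\<close> by blast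
        moreover have "?A \<subseteq> I v" using v by (auto simp: mem_I)
        ultimately show ?thesis using nomax by blast
      next
        case False
        then show ?thesis using m(2)[of v] \<open>v \<in> I u\<close> v(2) le_antisym[of v m] by blast
      qed
    qed
    then have "minimal_upper_bound T r ?A m"
      unfolding minimal_upper_bound_def using ub m in_T(1)[of m u] by (auto simp: mem_I)
    then show ?thesis using m by blast
  qed
  obtain m where m: "m \<in> I t - I w" "minimal_upper_bound T r ?A m" using first[OF t w] by blast
  obtain m' where m': "m' \<in> I w - I t" "minimal_upper_bound T r ?A m'" using first[OF w t] by blast
  have "c \<sqsubseteq> d \<or> d \<sqsubseteq> c" if "c \<in> ?A" "d \<in> ?A" for c d
    using le_linear[of c t d] lt_le[of d c] that by (auto simp: mem_I)
  then have "?A \<in> Chains r" unfolding Chains_def by blast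
  moreover have "?A \<subseteq> T" using I_subset by blast
  moreover have "\<forall>C u v. C \<subseteq> T \<and> C \<noteq> {} \<and> C \<in> Chains r \<and>
      minimal_upper_bound T r C u \<and> minimal_upper_bound T r C v \<longrightarrow> u = v"
    using tree unfolding tree_def by blast
  ultimately have "m = m'" using m m' ne by blast
  then show False using m m' by blast
qed

text \<open>
  A neighbourhood of \<open>t\<close> contains a final segment \<open>(s,t]\<close> of the branch, or all of \<open>(0,t]\<close>. The
  basic open sets \<open>T - I w\<close> are the only case that needs the assumption on minimal upper bounds.
\<close>

lemma open_nbhd:
  assumes "openin X U" "t \<in> U"
  shows "I t \<subseteq> U \<or> (\<exists>s. s \<sqsubset> t \<and> I t - I s \<subseteq> U)"
proof -
  have "generate_topology_on (\<Union>t\<in>T. {I t, T - I t}) U"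
    using assms(1) unfolding interval_topology_def openin_topology_generated_by_iff .
  then show ?thesis using assms(2)
  proof (induction arbitrary: t rule: generate_topology_on.induct)
    case Empty
    then show ?case by simp
  next
    case (Int A B)
    have "A \<inter> B \<supseteq> I t" if "I t \<subseteq> A" "I t \<subseteq> B" using that by blast
    moreover have "I t - I s \<subseteq> A \<inter> B" if "I t \<subseteq> A" "I t - I s \<subseteq> B" for s using that by blast
    moreover have "I t - I s \<subseteq> A \<inter> B" if "I t \<subseteq> B" "I t - I s \<subseteq> A" for s using that by blast
    moreover have "\<exists>s. s \<sqsubset> t \<and> I t - I s \<subseteq> A \<inter> B"
      if s: "s \<sqsubset> t" "I t - I s \<subseteq> A" "s' \<sqsubset> t" "I t - I s' \<subseteq> B" for s s'
    proof -
      have "I s \<subseteq> I s' \<or> I s' \<subseteq> I s" using s le_linear[of s t s'] I_mono lt_le by blast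
      then show ?thesis using s by blast
    qed
    moreover have "I t \<subseteq> A \<or> (\<exists>s. s \<sqsubset> t \<and> I t - I s \<subseteq> A)"
      "I t \<subseteq> B \<or> (\<exists>s. s \<sqsubset> t \<and> I t - I s \<subseteq> B)"
      using Int.IH Int.prems by blast+
    ultimately show ?case by blast
  next
    case (UN K)
    then obtain k where "k \<in> K" "t \<in> k" by blast
    then show ?case using UN.IH[of k t] by (meson Sup_upper order_trans)
  next
    case (Basis A)
    then obtain w where w: "w \<in> T" "A = I w \<or> A = T - I w" by blast
    show ?case
    proof (cases "A = I w")
      case True
      then show ?thesis using Basis.prems I_mono by (auto simp: mem_I)
    next
      case False
      then have A: "A = T - I w" "t \<in> T" "t \<notin> I w" using w Basis.prems by auto
      show ?thesis
      proof (cases "I t \<inter> I w = {}")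
        case True
        then show ?thesis using A I_subset by blast
      next
        case False
        then obtain s where s: "s \<in> I t \<inter> I w" "I t \<inter> I w \<subseteq> I s"
          using I_Int_I_greatest[OF A(2) w(1) False] by blast
        then have "s \<sqsubset> t" using A unfolding tree_less_def by (auto simp: mem_I)
        moreover have "I t - I s \<subseteq> A" using s A I_subset by blast
        ultimately show ?thesis by blast
      qed
    qed
  qed
qed

lemma compactin_I:
  assumes "t \<in> T" shows "compactin X (I t)"
  using assms
proof (induction rule: tree_induct)
  case (less t)
  show ?case
    unfolding compactin_def
  proof (intro conjI allI impI)
    show "I t \<subseteq> topspace X" using I_subset topspace_X by simp
    fix \<U> assume \<U>: "(\<forall>U\<in>\<U>. openin X U) \<and> I t \<subseteq> \<Union>\<U>"
    have "t \<in> I t" using le_refl less by (simp add: mem_I)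
    then obtain U where U: "U \<in> \<U>" "t \<in> U" using \<U> by blast
    then consider "I t \<subseteq> U" | s where "s \<sqsubset> t" "I t - I s \<subseteq> U"
      using open_nbhd[of U t] \<U> by blast
    then show "\<exists>\<F>. finite \<F> \<and> \<F> \<subseteq> \<U> \<and> I t \<subseteq> \<Union>\<F>"
    proof cases
      case 1
      then show ?thesis using U by (intro exI[of _ "{U}"]) auto
    next
      case (2 s)
      then have "I s \<subseteq> \<Union>\<U>" using \<U> I_mono[of s t] lt_le by blast
      then obtain \<F> where "finite \<F>" "\<F> \<subseteq> \<U>" "I s \<subseteq> \<Union>\<F>"
        using less.IH[OF 2(1)] \<U> unfolding compactin_def by metis
      then show ?thesis using 2 U by (intro exI[of _ "insert U \<F>"]) auto
    qed
  qed
qed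

end

section \<open>The space of continuous functions\<close>

context interval_tree
begin

abbreviation V :: "('a \<Rightarrow> real) set" where "V \<equiv> C0 X"

text \<open>The indicator function of \<open>(0,t]\<close>.\<close>

definition ind :: "'a \<Rightarrow> 'a \<Rightarrow> real" where "ind t v = (if v \<sqsubseteq> t then 1 else 0)"

lemma continuous_map_X_iff:
  "continuous_map X euclideanreal f \<longleftrightarrow>
    (\<forall>x\<in>T. \<forall>e>0. \<exists>U. openin X U \<and> x \<in> U \<and> (\<forall>y\<in>U. \<bar>f x - f y\<bar> < e))"
  using Met_TC.continuous_map_to_metric[of X f]
  by (simp add: topspace_X dist_real_def)

lemma ind_in_V: assumes t: "t \<in> T" shows "ind t \<in> V"
proof -
  have "\<exists>U. openin X U \<and> x \<in> U \<and> (\<forall>y\<in>U. \<bar>ind t x - ind t y\<bar> < e)" if "x \<in> T" "e > 0" for x and e :: real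
  proof (cases "x \<in> I t")
    case True
    then show ?thesis using openin_I[OF t] that by (intro exI[of _ "I t"]) (auto simp: ind_def mem_I)
  next
    case False
    then show ?thesis using openin_I[OF t] that
      by (intro exI[of _ "T - I t"]) (auto simp: ind_def mem_I)
  qed
  then have "continuous_map X euclideanreal (ind t)" unfolding continuous_map_X_iff by blast
  moreover have "\<exists>K. compactin X K \<and> (\<forall>x \<in> topspace X - K. \<bar>ind t x\<bar> < e)" if "e > 0" for e :: real
    using compactin_I[OF t] that by (intro exI[of _ "I t"]) (auto simp: ind_def mem_I)
  moreover have "ind t x = 0" if "x \<notin> topspace X" for x
    using that in_T(1)[of x t] by (auto simp: ind_def topspace_X)
  ultimately show ?thesis unfolding C0_def by blast
qed

lemma V_zero: "(\<lambda>v. 0) \<in> V"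
  unfolding C0_def by (auto intro!: exI[of _ "{}"])

lemma V_outside: "f \<in> V \<Longrightarrow> v \<notin> T \<Longrightarrow> f v = 0"
  unfolding C0_def by (simp add: topspace_X)

lemma V_add: assumes "f \<in> V" "g \<in> V" shows "(\<lambda>v. f v + g v) \<in> V"
proof -
  have "\<exists>K. compactin X K \<and> (\<forall>x \<in> topspace X - K. \<bar>f x + g x\<bar> < e)" if e: "e > 0" for e :: real
  proof -
    have e2: "e / 2 > 0" using e by simp
    obtain K where K: "compactin X K" "\<forall>x \<in> topspace X - K. \<bar>f x\<bar> < e / 2"
      using assms(1) e2 unfolding C0_def by blast
    obtain K' where K': "compactin X K'" "\<forall>x \<in> topspace X - K'. \<bar>g x\<bar> < e / 2"
      using assms(2) e2 unfolding C0_def by blast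
    have "\<bar>f x + g x\<bar> < e" if "x \<in> topspace X - (K \<union> K')" for x
    proof -
      have "\<bar>f x\<bar> < e / 2" "\<bar>g x\<bar> < e / 2" using K(2) K'(2) that by blast+
      then show ?thesis by linarith
    qed
    then show ?thesis using compactin_Un[OF K(1) K'(1)] by blast
  qed
  then show ?thesis using assms unfolding C0_def by (auto intro: continuous_map_add)
qed

lemma V_scale: assumes "f \<in> V" shows "(\<lambda>v. k * f v) \<in> V"
proof -
  have "\<exists>K. compactin X K \<and> (\<forall>x \<in> topspace X - K. \<bar>k * f x\<bar> < e)" if e: "e > 0" for e :: real
  proof -
    have e2: "e / (\<bar>k\<bar> + 1) > 0" using e by (simp add: add_nonneg_pos)
    then obtain K where K: "compactin X K" "\<forall>x \<in> topspace X - K. \<bar>f x\<bar> < e / (\<bar>k\<bar> + 1)"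
      using assms unfolding C0_def by blast
    have "\<bar>k * f x\<bar> < e" if "x \<in> topspace X - K" for x
    proof -
      have "(\<bar>k\<bar> + 1) * \<bar>f x\<bar> < e"
        using K(2) that by (simp add: pos_less_divide_eq add_nonneg_pos mult.commute)
      moreover have "\<bar>k * f x\<bar> \<le> (\<bar>k\<bar> + 1) * \<bar>f x\<bar>" by (simp add: abs_mult algebra_simps)
      ultimately show ?thesis by linarith
    qed
    then show ?thesis using K(1) by blast
  qed
  then show ?thesis using assms unfolding C0_def by (auto intro: continuous_map_real_mult_left)
qed

lemma V_diff: "f \<in> V \<Longrightarrow> g \<in> V \<Longrightarrow> (\<lambda>v. f v - g v) \<in> V"
  using V_add[of f "\<lambda>v. (-1) * g v"] V_scale[of g "-1"] by simp

lemma V_sum: "(\<And>i. i \<in> A \<Longrightarrow> f i \<in> V) \<Longrightarrow> (\<lambda>v. \<Sum>i\<in>A. f i v) \<in> V"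
proof (induction A rule: infinite_finite_induct)
  case (insert i A)
  then show ?case using V_add[of "f i" "\<lambda>v. \<Sum>i\<in>A. f i v"] by simp
qed (simp_all add: V_zero)

lemma V_uniform_limit:
  assumes approx: "\<And>e. e > 0 \<Longrightarrow> \<exists>g\<in>V. \<forall>v. \<bar>f v - g v\<bar> \<le> e"
  shows "f \<in> V"
proof -
  have "\<exists>U. openin X U \<and> x \<in> U \<and> (\<forall>y\<in>U. \<bar>f x - f y\<bar> < e)" if x: "x \<in> T" and e: "e > 0" for x and e :: real
  proof -
    have e4: "e / 4 > 0" using e by simp
    then obtain g where g: "g \<in> V" "\<forall>v. \<bar>f v - g v\<bar> \<le> e / 4" using approx by blast
    then have "continuous_map X euclideanreal g" unfolding C0_def by blast
    then obtain U where U: "openin X U" "x \<in> U" "\<forall>y\<in>U. \<bar>g x - g y\<bar> < e / 4"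
      unfolding continuous_map_X_iff using x e4 by meson
    have "\<bar>f x - f y\<bar> < e" if "y \<in> U" for y
    proof -
      have "\<bar>g x - g y\<bar> < e / 4" "\<bar>f x - g x\<bar> \<le> e / 4" "\<bar>f y - g y\<bar> \<le> e / 4" using U g that by blast+
      then show ?thesis using e by (simp add: abs_if split: if_splits)
    qed
    then show ?thesis using U by blast
  qed
  then have "continuous_map X euclideanreal f" unfolding continuous_map_X_iff by blast
  moreover have "\<exists>K. compactin X K \<and> (\<forall>x \<in> topspace X - K. \<bar>f x\<bar> < e)" if e: "e > 0" for e :: real
  proof -
    have e2: "e / 2 > 0" using e by simp
    then obtain g where g: "g \<in> V" "\<forall>v. \<bar>f v - g v\<bar> \<le> e / 2" using approx by blast
    then obtain K where K: "compactin X K" "\<forall>x \<in> topspace X - K. \<bar>g x\<bar> < e / 2"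
      using e2 unfolding C0_def by blast
    have "\<bar>f x\<bar> < e" if "x \<in> topspace X - K" for x
    proof -
      have "\<bar>f x - g x\<bar> \<le> e / 2" "\<bar>g x\<bar> < e / 2" using K g that by blast+
      then show ?thesis by linarith
    qed
    then show ?thesis using K by blast
  qed
  moreover have "f v = 0" if v: "v \<notin> topspace X" for v
  proof (rule ccontr)
    assume "f v \<noteq> 0"
    then obtain g where "g \<in> V" "\<bar>f v - g v\<bar> \<le> \<bar>f v\<bar> / 2" using approx[of "\<bar>f v\<bar> / 2"] by auto
    then show False using V_outside[of g v] v \<open>f v \<noteq> 0\<close> by (simp add: topspace_X)
  qed
  ultimately show ?thesis unfolding C0_def by blast
qed

lemma V_bounded: assumes f: "f \<in> V" shows "\<exists>M. \<forall>v. \<bar>f v\<bar> \<le> M"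
proof -
  have "(1::real) > 0" by simp
  then obtain K where K: "compactin X K" "\<forall>x \<in> topspace X - K. \<bar>f x\<bar> < 1"
    using f unfolding C0_def by blast
  have "compactin euclideanreal (f ` K)"
    using image_compactin[OF K(1)] f unfolding C0_def by blast
  then have "bounded (f ` K)" by (simp add: compact_imp_bounded)
  then obtain M where M: "\<And>x. x \<in> K \<Longrightarrow> \<bar>f x\<bar> \<le> M" unfolding bounded_iff by auto
  have "\<bar>f v\<bar> \<le> max M 1" for v
  proof (cases "v \<in> K")
    case True
    then show ?thesis using M by (simp add: le_max_iff_disj)
  next
    case False
    then show ?thesis using K(2) V_outside[OF f, of v]
      by (cases "v \<in> T") (auto simp: topspace_X le_max_iff_disj less_imp_le)
  qed
  then show ?thesis by blast
qed

lemma abs_le_sup_norm: assumes "f \<in> V" shows "\<bar>f v\<bar> \<le> sup_norm f"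
proof -
  obtain M where "\<forall>v. \<bar>f v\<bar> \<le> M" using V_bounded[OF assms] by blast
  then have "bdd_above (range (\<lambda>v. \<bar>f v\<bar>))" by (auto intro: bdd_aboveI2)
  then show ?thesis unfolding sup_norm_def by (rule cSUP_upper[OF UNIV_I])
qed

lemma sup_norm_le: "(\<And>v. \<bar>f v\<bar> \<le> M) \<Longrightarrow> sup_norm f \<le> M" for f :: "'a \<Rightarrow> real"
  unfolding sup_norm_def by (rule cSUP_least) auto

end

section \<open>Staircase functions along a branch\<close>

text \<open>
  The bounds \<open>a\<close> and \<open>b\<close> are parameters, since the construction of the levels depends on \<open>a\<close>.
\<close>

locale renormed_tree = interval_tree +
  fixes N :: "('a \<Rightarrow> real) \<Rightarrow> real" and a b :: real
  assumes N_scale: "f \<in> V \<Longrightarrow> N (\<lambda>v. k * f v) = \<bar>k\<bar> * N f"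
    and N_triangle: "f \<in> V \<Longrightarrow> g \<in> V \<Longrightarrow> N (\<lambda>v. f v + g v) \<le> N f + N g"
    and a_pos: "0 < a" and b_pos: "0 < b"
    and N_lower: "f \<in> V \<Longrightarrow> a * sup_norm f \<le> N f"
    and N_upper: "f \<in> V \<Longrightarrow> N f \<le> b * sup_norm f"
    and smooth: "Gateaux_smooth_on V N"
begin

lemma N_le: assumes "f \<in> V" "\<And>v. \<bar>f v\<bar> \<le> M" shows "N f \<le> b * M"
proof -
  have "b * sup_norm f \<le> b * M" using sup_norm_le[of f M] assms(2) b_pos by simp
  then show ?thesis using N_upper[OF assms(1)] by linarith
qed

lemma N_ge: assumes "f \<in> V" shows "a * \<bar>f v\<bar> \<le> N f"
proof -
  have "a * \<bar>f v\<bar> \<le> a * sup_norm f" using abs_le_sup_norm[OF assms] a_pos by simp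
  then show ?thesis using N_lower[OF assms] by linarith
qed

lemma N_near: assumes "f \<in> V" "g \<in> V" "\<And>v. \<bar>f v - g v\<bar> \<le> M" shows "N f \<le> N g + b * M"
  using N_triangle[OF assms(2) V_diff[OF assms(1,2)]] N_le[OF V_diff[OF assms(1,2)] assms(3)] by simp

text \<open>
  The functions that extend the restriction of \<open>g\<close> to \<open>(0,t]\<close> and vanish at the points incomparable
  to \<open>t\<close>. By the second requirement, extensions belonging to incomparable points of the tree differ
  from zero simultaneously only below one of these points.
\<close>

definition ext :: "'a \<Rightarrow> ('a \<Rightarrow> real) \<Rightarrow> ('a \<Rightarrow> real) set"
  where "ext t g = {f \<in> V. (\<forall>v. v \<sqsubseteq> t \<longrightarrow> f v = g v) \<and> (\<forall>v. \<not> v \<sqsubseteq> t \<and> \<not> t \<sqsubseteq> v \<longrightarrow> f v = 0)}"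

text \<open>
  The infimum of the norm over \<open>ext t g\<close> is at most \<open>K\<close>; in particular \<open>ext t g\<close> is non-empty.
\<close>

definition feas :: "'a \<Rightarrow> ('a \<Rightarrow> real) \<Rightarrow> real \<Rightarrow> bool"
  where "feas t g K \<longleftrightarrow> (\<forall>e>0. \<exists>f\<in>ext t g. N f < K + e)"

lemma ext_mono: assumes "s \<sqsubseteq> t" shows "ext t g \<subseteq> ext s g"
  using le_trans[OF _ assms] le_trans[OF assms] le_linear[OF _ assms] lt_le
  unfolding ext_def by blast

lemma feas_mono: "s \<sqsubseteq> t \<Longrightarrow> feas t g K \<Longrightarrow> feas s g K"
  unfolding feas_def using ext_mono by blast

lemma ext_cong: "(\<And>v. v \<sqsubseteq> t \<Longrightarrow> g v = g' v) \<Longrightarrow> ext t g = ext t g'"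
  unfolding ext_def by auto

lemma feas_cong: "(\<And>v. v \<sqsubseteq> t \<Longrightarrow> g v = g' v) \<Longrightarrow> feas t g K \<longleftrightarrow> feas t g' K"
  unfolding feas_def using ext_cong[of t g g'] by simp

lemma ext_shift:
  assumes "f \<in> ext t g" "h \<in> V" "\<And>v. v \<sqsubseteq> t \<Longrightarrow> g' v = g v + h v" "\<And>v. \<not> v \<sqsubseteq> t \<Longrightarrow> h v = 0"
  shows "(\<lambda>v. f v + h v) \<in> ext t g'"
  using assms V_add[of f h] unfolding ext_def by auto

text \<open>
  For \<open>v\<close> in \<open>(0,t]\<close> the value of the staircase of \<open>t\<close> at \<open>v\<close> is settled at stage \<open>\<eta>\<close>: no point
  below \<open>v\<close> has the levels of \<open>t\<close> up to \<open>\<eta>\<close>. Equivalently, \<open>v\<close> does not lie above the first such point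
  of the branch (\<open>settled_point\<close>).
\<close>

definition settled :: "(cord \<Rightarrow> 'a \<Rightarrow> real) \<Rightarrow> cord \<Rightarrow> 'a \<Rightarrow> 'a \<Rightarrow> bool"
  where "settled x \<eta> t v \<longleftrightarrow> \<not> (\<exists>s. s \<sqsubset> v \<and> (\<forall>\<zeta>\<le>\<eta>. x \<zeta> s = x \<zeta> t))"

text \<open>
  The staircase of \<open>t\<close> before stage \<open>\<xi>\<close>, with the value \<open>l\<close> where it is not yet settled.
\<close>

definition stair :: "(cord \<Rightarrow> 'a \<Rightarrow> real) \<Rightarrow> cord \<Rightarrow> 'a \<Rightarrow> real \<Rightarrow> 'a \<Rightarrow> real"
  where "stair x \<xi> t l v =
    (if \<exists>\<eta><\<xi>. settled x \<eta> t v then x (LEAST \<eta>. settled x \<eta> t v) t else l)"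

text \<open>
  The supremum of the levels before \<open>\<xi>\<close>. Levels are non-negative, and the inserted \<open>0\<close> only gives
  stage \<open>0\<close> a lower bound.
\<close>

definition base :: "(cord \<Rightarrow> 'a \<Rightarrow> real) \<Rightarrow> cord \<Rightarrow> 'a \<Rightarrow> real"
  where "base x \<xi> t = Sup (insert 0 ((\<lambda>\<eta>. x \<eta> t) ` {..<\<xi>}))"

text \<open>
  The heights to which the staircase may be raised at stage \<open>\<xi>\<close>. If nothing is left unsettled on
  \<open>(0,t]\<close>, all heights are affordable, and only the bound \<open>2 / a + 1\<close> is in force. It exceeds every
  height that is affordable otherwise, so that the level \<open>2 / a + 1\<close> marks this case.
\<close>

definition candidates :: "(cord \<Rightarrow> 'a \<Rightarrow> real) \<Rightarrow> cord \<Rightarrow> 'a \<Rightarrow> real set"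
  where "candidates x \<xi> t =
    {l. base x \<xi> t \<le> l \<and> l \<le> 2 / a + 1 \<and> feas t (stair x \<xi> t l) (1 + a / 2 * l)}"

text \<open>
  No raising takes place at limit stages, because the elements of \<open>Z\<close> are continuous sequences.
\<close>

definition step :: "(cord \<Rightarrow> 'a \<Rightarrow> real) \<Rightarrow> cord \<Rightarrow> 'a \<Rightarrow> real"
  where "step x \<xi> t = (if is_limit \<xi> then base x \<xi> t else Sup (candidates x \<xi> t))"

text \<open>The level of a point at each stage.\<close>

definition lev :: "cord \<Rightarrow> 'a \<Rightarrow> real"
  where "lev = wfrec {(\<eta>, \<xi>). \<eta> < \<xi>} step"

lemma Least_cong_below:
  fixes P Q :: "cord \<Rightarrow> bool"
  assumes "\<And>\<eta>. \<eta> < \<xi> \<Longrightarrow> P \<eta> = Q \<eta>" "\<exists>\<eta><\<xi>. P \<eta>"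
  shows "(LEAST \<eta>. P \<eta>) = (LEAST \<eta>. Q \<eta>)" "(LEAST \<eta>. P \<eta>) < \<xi>"
proof -
  obtain \<eta> where \<eta>: "\<eta> < \<xi>" "P \<eta>" using assms(2) by blast
  have P: "P (LEAST \<eta>. P \<eta>)" using \<eta>(2) by (rule LeastI)
  show less: "(LEAST \<eta>. P \<eta>) < \<xi>" using Least_le[of P, OF \<eta>(2)] \<eta>(1) by simp
  show "(LEAST \<eta>. P \<eta>) = (LEAST \<eta>. Q \<eta>)"
  proof (rule Least_equality[symmetric])
    show "Q (LEAST \<eta>. P \<eta>)" using P less assms(1) by blast
    fix y assume "Q y"
    then show "(LEAST \<eta>. P \<eta>) \<le> y" using assms(1)[of y] Least_le[of P y] less by (cases "y < \<xi>") auto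
  qed
qed

lemma stair_cong:
  assumes "\<And>\<eta>. \<eta> < \<xi> \<Longrightarrow> settled x \<eta> s v = settled y \<eta> t v" "\<And>\<eta>. \<eta> < \<xi> \<Longrightarrow> x \<eta> s = y \<eta> t"
  shows "stair x \<xi> s l v = stair y \<xi> t l v"
proof (cases "\<exists>\<eta><\<xi>. settled x \<eta> s v")
  case True
  then have "\<exists>\<eta><\<xi>. settled y \<eta> t v" using assms(1) by auto
  then show ?thesis using True Least_cong_below[of \<xi> "\<lambda>\<eta>. settled x \<eta> s v" "\<lambda>\<eta>. settled y \<eta> t v"] assms
    unfolding stair_def by simp
next
  case False
  then have "\<not> (\<exists>\<eta><\<xi>. settled y \<eta> t v)" using assms(1) by auto
  then show ?thesis using False unfolding stair_def by (simp only: if_False)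
qed

lemma step_cong:
  assumes eq: "\<And>\<eta>. \<eta> < \<xi> \<Longrightarrow> x \<eta> = y \<eta>"
  shows "step x \<xi> = step y \<xi>"
proof
  fix t
  have s: "settled x \<eta> t v = settled y \<eta> t v" if "\<eta> < \<xi>" for \<eta> v
  proof -
    have "x \<zeta> = y \<zeta>" if "\<zeta> \<le> \<eta>" for \<zeta> using eq \<open>\<eta> < \<xi>\<close> that by auto
    then show ?thesis unfolding settled_def by simp
  qed
  have "stair x \<xi> t l v = stair y \<xi> t l v" for l v
    by (rule stair_cong) (use s eq in auto)
  then have "stair x \<xi> t l = stair y \<xi> t l" for l by blast
  moreover have "base x \<xi> t = base y \<xi> t" unfolding base_def using eq by (simp cong: image_cong_simp)
  ultimately show "step x \<xi> t = step y \<xi> t" unfolding step_def candidates_def by simp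
qed

lemma lev_unfold: "lev \<xi> = step lev \<xi>"
proof -
  have "wf {(\<eta>, \<xi> :: cord). \<eta> < \<xi>}" using wf by blast
  then have "lev \<xi> = step (cut lev {(\<eta>, \<xi>). \<eta> < \<xi>} \<xi>) \<xi>" unfolding lev_def by (rule wfrec)
  also have "\<dots> = step lev \<xi>" by (rule step_cong) (simp add: cut_def)
  finally show ?thesis .
qed

section \<open>Existence and monotonicity of the levels\<close>

text \<open>\<open>D\<close> abbreviates \<open>settled\<close> and \<open>S\<close> abbreviates \<open>stair\<close>, for the levels \<open>lev\<close>.\<close>

abbreviation D :: "cord \<Rightarrow> 'a \<Rightarrow> 'a \<Rightarrow> bool" where "D \<equiv> settled lev"
abbreviation S :: "cord \<Rightarrow> 'a \<Rightarrow> real \<Rightarrow> 'a \<Rightarrow> real" where "S \<equiv> stair lev"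

text \<open>Equality of all levels before stage \<open>\<xi>\<close>.\<close>

definition agree :: "cord \<Rightarrow> 'a \<Rightarrow> 'a \<Rightarrow> bool"
  where "agree \<xi> s t \<longleftrightarrow> (\<forall>\<eta><\<xi>. lev \<eta> s = lev \<eta> t)"

lemma agree_sym: "agree \<xi> s t \<Longrightarrow> agree \<xi> t s" unfolding agree_def by simp

lemma agree_csuc: "agree (csuc \<eta>) s t \<longleftrightarrow> (\<forall>\<zeta>\<le>\<eta>. lev \<zeta> s = lev \<zeta> t)"
  unfolding agree_def less_csuc_iff ..

lemma D_iff: "D \<eta> t v \<longleftrightarrow> \<not> (\<exists>s. s \<sqsubset> v \<and> agree (csuc \<eta>) s t)"
  unfolding settled_def agree_csuc ..

lemma D_mono: "\<eta> \<le> \<zeta> \<Longrightarrow> D \<eta> t v \<Longrightarrow> D \<zeta> t v"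
  unfolding settled_def using order_trans by blast

lemma D_agree: assumes "agree \<xi> s t" "\<eta> < \<xi>" shows "D \<eta> s v = D \<eta> t v"
proof -
  have "lev \<zeta> s = lev \<zeta> t" if "\<zeta> \<le> \<eta>" for \<zeta> using assms that unfolding agree_def by auto
  then show ?thesis unfolding settled_def by simp
qed

lemma S_agree: assumes "agree \<xi> s t" shows "S \<xi> s l = S \<xi> t l"
proof
  fix v show "S \<xi> s l v = S \<xi> t l v"
    by (rule stair_cong) (use D_agree[OF assms] assms agree_def in auto)
qed

lemma S_unsettled: "(\<And>\<eta>. \<eta> < \<xi> \<Longrightarrow> \<not> D \<eta> t v) \<Longrightarrow> S \<xi> t l v = l"
  unfolding stair_def by auto

lemma S_settled:
  assumes "\<eta> < \<xi>" "D \<eta> t v"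
  shows "S \<xi> t l v = S \<eta> t (lev \<eta> t) v"
proof (cases "\<exists>\<zeta><\<eta>. D \<zeta> t v")
  case True
  then have "\<exists>\<zeta><\<xi>. D \<zeta> t v" using assms by blast
  then show ?thesis using True unfolding stair_def by simp
next
  case False
  then have "(LEAST \<eta>. D \<eta> t v) = \<eta>"
    using assms by (intro Least_equality) (auto simp: not_less[symmetric])
  then show ?thesis using False assms unfolding stair_def by auto
qed

text \<open>
  Where the staircase is not settled at stage \<open>\<eta>\<close>, its later values stay between the level at
  stage \<open>\<eta>\<close> and the top value.
\<close>

lemma S_bounds:
  assumes "\<And>\<zeta>. \<eta> \<le> \<zeta> \<Longrightarrow> \<zeta> < \<xi> \<Longrightarrow> lev \<eta> t \<le> lev \<zeta> t \<and> lev \<zeta> t \<le> l"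
    and "lev \<eta> t \<le> l" "\<not> D \<eta> t v"
  shows "lev \<eta> t \<le> S \<xi> t l v \<and> S \<xi> t l v \<le> l"
proof (cases "\<exists>\<zeta><\<xi>. D \<zeta> t v")
  case True
  let ?k = "LEAST \<zeta>. D \<zeta> t v"
  have "?k < \<xi>" using Least_cong_below(2)[of \<xi> "\<lambda>\<zeta>. D \<zeta> t v" "\<lambda>\<zeta>. D \<zeta> t v"] True by blast
  moreover have "D ?k t v" using True LeastI_ex[of "\<lambda>\<zeta>. D \<zeta> t v"] by blast
  moreover have "\<eta> \<le> ?k" using calculation(2) assms(3) D_mono[of ?k \<eta> t v] by (meson linear)
  ultimately show ?thesis using assms(1)[of ?k] True unfolding stair_def by simp
next
  case False
  then show ?thesis using S_unsettled[of \<xi> t v l] assms(2) by auto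
qed

lemma settled_point:
  assumes t: "t \<in> T"
  obtains s where "s \<sqsubseteq> t" "agree (csuc \<eta>) s t" "\<And>v. v \<sqsubseteq> t \<Longrightarrow> D \<eta> t v \<longleftrightarrow> v \<sqsubseteq> s"
proof -
  let ?A = "{s. s \<sqsubseteq> t \<and> agree (csuc \<eta>) s t}"
  have "t \<in> ?A" using le_refl[OF t] by (simp add: agree_def)
  then have ne: "?A \<noteq> {}" by blast
  obtain s where s: "s \<in> ?A" "\<And>v. v \<in> ?A \<Longrightarrow> s \<sqsubseteq> v"
    by (rule tree_least[OF t _ ne]) (auto simp: mem_I)
  have "D \<eta> t v \<longleftrightarrow> v \<sqsubseteq> s" if v: "v \<sqsubseteq> t" for v
  proof
    assume "D \<eta> t v"
    then have "\<not> s \<sqsubset> v" unfolding D_iff using s(1) by blast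
    then show "v \<sqsubseteq> s" using le_linear[of v t s] v s(1) by blast
  next
    assume vs: "v \<sqsubseteq> s"
    show "D \<eta> t v"
    proof (rule ccontr)
      assume "\<not> D \<eta> t v"
      then obtain u where u: "u \<sqsubset> v" "agree (csuc \<eta>) u t" unfolding D_iff by blast
      then have "u \<in> ?A" using le_trans[OF lt_le[OF u(1)] v] by blast
      then have "s \<sqsubseteq> u" by (rule s(2))
      then show False using not_lt_le[OF lt_le_trans[OF u(1) vs]] by blast
    qed
  qed
  then show ?thesis using s(1) that by blast
qed

text \<open>
  The indicator function of the part of \<open>(0,t]\<close> that is not settled before stage \<open>\<xi>\<close>. Except at limit
  stages it is of the form \<open>(0,t]\<close> or \<open>(s,t]\<close>, hence clopen.
\<close>

definition room :: "cord \<Rightarrow> 'a \<Rightarrow> 'a \<Rightarrow> real"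
  where "room \<xi> t v = (if v \<sqsubseteq> t \<and> (\<forall>\<eta><\<xi>. \<not> D \<eta> t v) then 1 else 0)"

lemma room_csuc:
  assumes t: "t \<in> T"
  obtains s where "s \<sqsubseteq> t" "agree (csuc \<eta>) s t" "room (csuc \<eta>) t = (\<lambda>v. ind t v - ind s v)"
proof -
  obtain s where s: "s \<sqsubseteq> t" "agree (csuc \<eta>) s t" "\<And>v. v \<sqsubseteq> t \<Longrightarrow> D \<eta> t v \<longleftrightarrow> v \<sqsubseteq> s"
    by (rule settled_point[OF t, of \<eta>]) blast
  have "(\<forall>\<zeta><csuc \<eta>. \<not> D \<zeta> t v) \<longleftrightarrow> \<not> D \<eta> t v" for v
    unfolding less_csuc_iff using D_mono[of _ \<eta> t v] by blast
  then have "room (csuc \<eta>) t v = ind t v - ind s v" for v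
    using s(3)[of v] le_trans[of v s t] s(1) unfolding room_def ind_def by auto
  then show ?thesis using that s by blast
qed

lemma room_in_V: assumes t: "t \<in> T" and \<xi>: "\<not> is_limit \<xi>" shows "room \<xi> t \<in> V"
proof (cases \<xi> rule: cord_cases)
  case zero
  then have "room \<xi> t = ind t" unfolding room_def ind_def by auto
  then show ?thesis using ind_in_V[OF t] by simp
next
  case (suc \<eta>)
  obtain s where "s \<sqsubseteq> t" "room (csuc \<eta>) t = (\<lambda>v. ind t v - ind s v)" by (rule room_csuc[OF t])
  then show ?thesis using V_diff[OF ind_in_V[OF t] ind_in_V[of s]] suc in_T(1)[of s t] by simp
qed (use \<xi> in simp)

lemma S_shift: "v \<sqsubseteq> t \<Longrightarrow> S \<xi> t l' v = S \<xi> t l v + (l' - l) * room \<xi> t v"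
  unfolding stair_def room_def by auto

lemma ext_S_shift:
  assumes "t \<in> T" "\<not> is_limit \<xi>" "f \<in> ext t (S \<xi> t l)"
  shows "(\<lambda>v. f v + (l' - l) * room \<xi> t v) \<in> ext t (S \<xi> t l')"
  using assms(3) V_scale[OF room_in_V[OF assms(1,2)]]
  by (rule ext_shift) (auto simp: S_shift[of _ t \<xi> l' l] room_def)

lemma N_shift:
  assumes "t \<in> T" "\<not> is_limit \<xi>" "f \<in> V"
  shows "N (\<lambda>v. f v + (l' - l) * room \<xi> t v) \<le> N f + b * \<bar>l' - l\<bar>"
  using N_near[OF V_add[OF assms(3) V_scale[OF room_in_V[OF assms(1,2)]]] assms(3)]
  by (simp add: room_def)

text \<open>The staircase on \<open>(0,t]\<close>, extended by zero.\<close>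

definition Y :: "cord \<Rightarrow> 'a \<Rightarrow> real \<Rightarrow> 'a \<Rightarrow> real"
  where "Y \<xi> t l v = (if v \<sqsubseteq> t then S \<xi> t l v else 0)"

lemma Y_shift: "Y \<xi> t l' v = Y \<xi> t l v + (l' - l) * room \<xi> t v"
  using S_shift[of v t \<xi> l' l] by (auto simp: Y_def room_def)

lemma Y_ext: "Y \<xi> t l \<in> V \<Longrightarrow> Y \<xi> t l \<in> ext t (S \<xi> t l)"
  unfolding ext_def Y_def by auto

text \<open>The properties of the levels that are proved by transfinite induction.\<close>

definition good :: "cord \<Rightarrow> 'a \<Rightarrow> bool"
  where "good \<xi> t \<longleftrightarrow> (\<forall>\<eta><\<xi>. lev \<eta> t \<le> lev \<xi> t) \<and> 0 \<le> lev \<xi> t \<and> lev \<xi> t \<le> 2 / a + 1 \<and>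
    Y \<xi> t (lev \<xi> t) \<in> V \<and> feas t (S \<xi> t (lev \<xi> t)) (1 + a / 2 * lev \<xi> t)"

text \<open>The set of candidates is closed, so the level is its maximum.\<close>

lemma Sup_candidates:
  assumes t: "t \<in> T" and \<xi>: "\<not> is_limit \<xi>" and base: "base lev \<xi> t \<in> candidates lev \<xi> t"
  shows "lev \<xi> t \<in> candidates lev \<xi> t" "\<And>l. l \<in> candidates lev \<xi> t \<Longrightarrow> l \<le> lev \<xi> t"
proof -
  let ?A = "candidates lev \<xi> t"
  have L: "lev \<xi> t = Sup ?A" using lev_unfold[of \<xi>] \<xi> unfolding step_def by metis
  have bdd: "bdd_above ?A" unfolding candidates_def by (auto intro: bdd_aboveI)
  show upper: "l \<le> lev \<xi> t" if "l \<in> ?A" for l unfolding L using that bdd by (rule cSup_upper)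
  have "lev \<xi> t \<le> 2 / a + 1"
    unfolding L using base by (intro cSup_least) (auto simp: candidates_def)
  moreover have "feas t (S \<xi> t (lev \<xi> t)) (1 + a / 2 * lev \<xi> t)"
    unfolding feas_def
  proof (intro allI impI)
    fix e :: real assume e: "e > 0"
    define d where "d = e / (2 * b)"
    have d: "d > 0" "b * d = e / 2" using e b_pos by (auto simp: d_def)
    obtain l where l: "l \<in> ?A" "lev \<xi> t - d < l"
      using less_cSup_iff[of ?A "lev \<xi> t - d"] base bdd d(1) L by auto
    then have "feas t (S \<xi> t l) (1 + a / 2 * l)" unfolding candidates_def by simp
    then obtain f where f: "f \<in> ext t (S \<xi> t l)" "N f < 1 + a / 2 * l + e / 2"
      unfolding feas_def using half_gt_zero[OF e] by blast
    let ?g = "\<lambda>v. f v + (lev \<xi> t - l) * room \<xi> t v"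
    have "N ?g \<le> N f + b * \<bar>lev \<xi> t - l\<bar>" using N_shift[OF t \<xi>] f unfolding ext_def by blast
    also have "b * \<bar>lev \<xi> t - l\<bar> \<le> b * d" using upper[OF l(1)] l(2) b_pos by simp
    finally have "N ?g < 1 + a / 2 * l + e" using f(2) d by simp
    also have "\<dots> \<le> 1 + a / 2 * lev \<xi> t + e" using upper[OF l(1)] a_pos by simp
    finally show "\<exists>f\<in>ext t (S \<xi> t (lev \<xi> t)). N f < 1 + a / 2 * lev \<xi> t + e"
      using ext_S_shift[OF t \<xi> f(1)] by blast
  qed
  moreover have "base lev \<xi> t \<le> lev \<xi> t" using upper base by blast
  ultimately show "lev \<xi> t \<in> ?A" unfolding candidates_def by blast
qed

lemma base_zero: "(\<And>\<eta>. \<not> \<eta> < \<xi>) \<Longrightarrow> base lev \<xi> t = 0"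
  unfolding base_def by (simp add: lessThan_def)

lemma base_csuc:
  assumes "good \<eta> t" shows "base lev (csuc \<eta>) t = lev \<eta> t"
  unfolding base_def
proof (rule cSup_eq_maximum)
  show "lev \<eta> t \<in> insert 0 ((\<lambda>\<eta>. lev \<eta> t) ` {..<csuc \<eta>})" using less_csuc by auto
  show "x \<le> lev \<eta> t" if "x \<in> insert 0 ((\<lambda>\<eta>. lev \<eta> t) ` {..<csuc \<eta>})" for x
    using that assms unfolding good_def by (auto simp: less_csuc_iff order_le_less)
qed

lemma S_csuc_base: "v \<sqsubseteq> t \<Longrightarrow> S (csuc \<eta>) t (lev \<eta> t) v = S \<eta> t (lev \<eta> t) v"
proof (cases "D \<eta> t v")
  case True
  then show ?thesis using S_settled[OF less_csuc] by blast
next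
  case False
  then have "\<not> D \<zeta> t v" if "\<zeta> \<le> \<eta>" for \<zeta> using D_mono that by blast
  then show ?thesis
    using S_unsettled[of "csuc \<eta>" t v] S_unsettled[of \<eta> t v] by (simp add: less_csuc_iff)
qed

lemma base_candidate:
  assumes t: "t \<in> T" and \<xi>: "\<not> is_limit \<xi>" and IH: "\<And>\<eta>. \<eta> < \<xi> \<Longrightarrow> good \<eta> t"
  shows "base lev \<xi> t \<in> candidates lev \<xi> t \<and> Y \<xi> t (base lev \<xi> t) \<in> V"
proof (cases \<xi> rule: cord_cases)
  case zero
  have S: "S \<xi> t 0 v = 0" for v using S_unsettled zero by blast
  then have Z: "Y \<xi> t 0 = (\<lambda>v. 0)" unfolding Y_def by auto
  have "N (\<lambda>v. 0) \<le> 0" using N_le[OF V_zero, of 0] by simp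
  then have "feas t (S \<xi> t 0) (1 + a / 2 * 0)"
    unfolding feas_def using S V_zero by (intro allI impI bexI[of _ "\<lambda>v. 0"]) (auto simp: ext_def)
  then show ?thesis unfolding candidates_def using Z V_zero a_pos by (simp add: base_zero[OF zero])
next
  case (suc \<eta>)
  have good: "good \<eta> t" using IH suc less_csuc by blast
  have "Y \<xi> t (lev \<eta> t) = Y \<eta> t (lev \<eta> t)" unfolding Y_def suc using S_csuc_base by auto
  moreover have "feas t (S \<xi> t (lev \<eta> t)) K \<longleftrightarrow> feas t (S \<eta> t (lev \<eta> t)) K" for K
    unfolding suc by (rule feas_cong) (rule S_csuc_base)
  ultimately show ?thesis
    using good base_csuc[OF good] suc unfolding good_def candidates_def by simp
qed (use \<xi> in simp)

lemma lev_limit: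
  assumes \<xi>: "is_limit \<xi>" and good: "\<And>\<eta>. \<eta> < \<xi> \<Longrightarrow> good \<eta> t"
  shows "\<eta> < \<xi> \<Longrightarrow> lev \<eta> t \<le> lev \<xi> t" "0 \<le> lev \<xi> t"
    "(\<And>\<eta>. \<eta> < \<xi> \<Longrightarrow> lev \<eta> t \<le> M) \<Longrightarrow> lev \<xi> t \<le> M"
    "e > 0 \<Longrightarrow> \<exists>\<eta><\<xi>. lev \<xi> t - e < lev \<eta> t"
proof -
  let ?A = "insert 0 ((\<lambda>\<eta>. lev \<eta> t) ` {..<\<xi>})"
  have L: "lev \<xi> t = Sup ?A"
    using lev_unfold[of \<xi>] \<xi> unfolding step_def base_def by metis
  have bdd: "bdd_above ?A"
    using good a_pos by (intro bdd_aboveI[of _ "2 / a + 1"]) (auto simp: good_def)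
  show le: "lev \<eta> t \<le> lev \<xi> t" if "\<eta> < \<xi>" for \<eta>
    unfolding L using that bdd by (intro cSup_upper) auto
  show "0 \<le> lev \<xi> t" unfolding L using bdd by (intro cSup_upper) auto
  obtain \<eta>0 where \<eta>0: "\<eta>0 < \<xi>" using \<xi> unfolding is_limit_def by blast
  have pos: "0 \<le> lev \<eta>0 t" using good[OF \<eta>0] unfolding good_def by blast
  show "lev \<xi> t \<le> M" if "\<And>\<eta>. \<eta> < \<xi> \<Longrightarrow> lev \<eta> t \<le> M"
    unfolding L using that that[OF \<eta>0] pos by (intro cSup_least) auto
  show "\<exists>\<eta><\<xi>. lev \<xi> t - e < lev \<eta> t" if e: "e > 0"
  proof -
    have "lev \<xi> t - e < Sup ?A" using e L by simp
    then obtain l where l: "l \<in> ?A" "lev \<xi> t - e < l"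
      using iffD1[OF less_cSup_iff[OF insert_not_empty bdd]] by blast
    show ?thesis
    proof (cases "l = 0")
      case True
      then show ?thesis using \<eta>0 pos l by (intro exI[of _ \<eta>0]) auto
    next
      case False
      then show ?thesis using l by auto
    qed
  qed
qed

lemma Y_close:
  assumes "\<eta> < \<xi>" "\<And>\<zeta>. \<eta> \<le> \<zeta> \<Longrightarrow> \<zeta> < \<xi> \<Longrightarrow> lev \<eta> t \<le> lev \<zeta> t \<and> lev \<zeta> t \<le> l" "lev \<eta> t \<le> l"
  shows "\<bar>Y \<xi> t l v - Y \<eta> t (lev \<eta> t) v\<bar> \<le> l - lev \<eta> t"
proof (cases "D \<eta> t v")
  case True
  then show ?thesis using S_settled[OF assms(1)] assms(3) unfolding Y_def by simp
next
  case False
  then have "S \<eta> t (lev \<eta> t) v = lev \<eta> t" using D_mono by (intro S_unsettled) (meson less_imp_le)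
  then show ?thesis using S_bounds[OF assms(2,3) False] assms(3) unfolding Y_def by auto
qed

lemma all_good: "t \<in> T \<Longrightarrow> good \<xi> t"
proof (induction \<xi> rule: less_induct)
  case (less \<xi>)
  have t: "t \<in> T" by fact
  have IH: "good \<eta> t" if "\<eta> < \<xi>" for \<eta> using less that by blast
  show ?case
  proof (cases "is_limit \<xi>")
    case False
    have base: "base lev \<xi> t \<in> candidates lev \<xi> t" "Y \<xi> t (base lev \<xi> t) \<in> V"
      using base_candidate[OF t False IH] by blast+
    have L: "lev \<xi> t \<in> candidates lev \<xi> t" using Sup_candidates[OF t False base(1)] by blast
    have bdd: "bdd_above (insert 0 ((\<lambda>\<eta>. lev \<eta> t) ` {..<\<xi>}))"
      using IH a_pos by (intro bdd_aboveI[of _ "2 / a + 1"]) (auto simp: good_def)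
    have "lev \<eta> t \<le> base lev \<xi> t" if "\<eta> < \<xi>" for \<eta>
      unfolding base_def using that bdd by (intro cSup_upper) auto
    moreover have "0 \<le> base lev \<xi> t"
      unfolding base_def using bdd by (intro cSup_upper) auto
    moreover have "Y \<xi> t (lev \<xi> t) \<in> V"
    proof -
      have "Y \<xi> t (lev \<xi> t) = (\<lambda>v. Y \<xi> t (base lev \<xi> t) v + (lev \<xi> t - base lev \<xi> t) * room \<xi> t v)"
        using Y_shift by blast
      then show ?thesis using V_add[OF base(2) V_scale[OF room_in_V[OF t False]]] by simp
    qed
    ultimately show ?thesis using L unfolding good_def candidates_def by fastforce
  next
    case True
    have lim: "\<And>\<eta>. \<eta> < \<xi> \<Longrightarrow> lev \<eta> t \<le> lev \<xi> t" "0 \<le> lev \<xi> t"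
      "\<And>M. (\<And>\<eta>. \<eta> < \<xi> \<Longrightarrow> lev \<eta> t \<le> M) \<Longrightarrow> lev \<xi> t \<le> M"
      "\<And>e. e > 0 \<Longrightarrow> \<exists>\<eta><\<xi>. lev \<xi> t - e < lev \<eta> t"
      using lev_limit[OF True, of t] IH by blast+
    have mono: "lev \<eta> t \<le> lev \<zeta> t \<and> lev \<zeta> t \<le> lev \<xi> t" if "\<eta> \<le> \<zeta>" "\<zeta> < \<xi>" for \<eta> \<zeta>
      using that IH[of \<zeta>] lim(1)[of \<zeta>] unfolding good_def by (auto simp: order_le_less)
    have close: "\<bar>Y \<xi> t (lev \<xi> t) v - Y \<eta> t (lev \<eta> t) v\<bar> \<le> lev \<xi> t - lev \<eta> t" if "\<eta> < \<xi>" for \<eta> v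
      using Y_close[OF that mono lim(1)[OF that]] .
    have ZV: "Y \<xi> t (lev \<xi> t) \<in> V"
    proof (rule V_uniform_limit)
      fix e :: real assume "e > 0"
      then obtain \<eta> where \<eta>: "\<eta> < \<xi>" "lev \<xi> t - e < lev \<eta> t" using lim(4) by blast
      have "\<bar>Y \<xi> t (lev \<xi> t) v - Y \<eta> t (lev \<eta> t) v\<bar> \<le> e" for v using close[OF \<eta>(1), of v] \<eta>(2) by linarith
      then show "\<exists>g\<in>V. \<forall>v. \<bar>Y \<xi> t (lev \<xi> t) v - g v\<bar> \<le> e"
        using IH[OF \<eta>(1)] unfolding good_def by blast
    qed
    have "feas t (S \<xi> t (lev \<xi> t)) (1 + a / 2 * lev \<xi> t)"
      unfolding feas_def
    proof (intro allI impI)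
      fix e :: real assume e: "e > 0"
      then obtain \<eta> where \<eta>: "\<eta> < \<xi>" "lev \<xi> t - e / (2 * b) < lev \<eta> t"
        using lim(4)[of "e / (2 * b)"] b_pos by auto
      have ZV': "Y \<eta> t (lev \<eta> t) \<in> V" using IH[OF \<eta>(1)] unfolding good_def by blast
      obtain f where f: "f \<in> ext t (S \<eta> t (lev \<eta> t))" "N f < 1 + a / 2 * lev \<eta> t + e / 2"
        using IH[OF \<eta>(1)] e unfolding good_def feas_def by (meson half_gt_zero)
      let ?h = "\<lambda>v. Y \<xi> t (lev \<xi> t) v - Y \<eta> t (lev \<eta> t) v"
      have h: "?h \<in> V" using V_diff[OF ZV ZV'] .
      have fV: "f \<in> V" using f unfolding ext_def by blast
      have "N (\<lambda>v. f v + ?h v) \<le> N f + b * (lev \<xi> t - lev \<eta> t)"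
        by (rule N_near[OF V_add[OF fV h] fV]) (use close[OF \<eta>(1)] in simp)
      also have "b * (lev \<xi> t - lev \<eta> t) \<le> e / 2" using \<eta>(2) b_pos by (simp add: field_simps)
      finally have "N (\<lambda>v. f v + ?h v) < 1 + a / 2 * lev \<eta> t + e" using f(2) by simp
      also have "\<dots> \<le> 1 + a / 2 * lev \<xi> t + e" using lim(1)[OF \<eta>(1)] a_pos by simp
      finally have "N (\<lambda>v. f v + ?h v) < 1 + a / 2 * lev \<xi> t + e" .
      moreover have "(\<lambda>v. f v + ?h v) \<in> ext t (S \<xi> t (lev \<xi> t))"
        by (rule ext_shift[OF f(1) h]) (auto simp: Y_def)
      ultimately show "\<exists>f\<in>ext t (S \<xi> t (lev \<xi> t)). N f < 1 + a / 2 * lev \<xi> t + e" by blast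
    qed
    moreover have "lev \<xi> t \<le> 2 / a + 1" using IH by (intro lim(3)) (auto simp: good_def)
    ultimately show ?thesis using ZV lim(1,2) unfolding good_def by blast
  qed
qed

lemma lev_mono: "t \<in> T \<Longrightarrow> \<eta> \<le> \<xi> \<Longrightarrow> lev \<eta> t \<le> lev \<xi> t"
  using all_good[of t \<xi>] unfolding good_def by (cases "\<eta> = \<xi>") auto

lemma lev_nonneg: "t \<in> T \<Longrightarrow> 0 \<le> lev \<xi> t"
  using all_good[of t \<xi>] unfolding good_def by blast

lemma lev_le_top: "t \<in> T \<Longrightarrow> lev \<xi> t \<le> 2 / a + 1"
  using all_good[of t \<xi>] unfolding good_def by blast

lemma lev_Y_in_V: "t \<in> T \<Longrightarrow> Y \<xi> t (lev \<xi> t) \<in> V"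
  using all_good[of t \<xi>] unfolding good_def by blast

lemma lev_feas: "t \<in> T \<Longrightarrow> feas t (S \<xi> t (lev \<xi> t)) (1 + a / 2 * lev \<xi> t)"
  using all_good[of t \<xi>] unfolding good_def by blast

lemma lev_limit_approx:
  assumes "t \<in> T" "is_limit \<xi>" "e > 0" shows "\<exists>\<eta><\<xi>. lev \<xi> t - e < lev \<eta> t"
  using lev_limit(4)[OF assms(2), of t e] all_good[OF assms(1)] assms(3) by blast

lemma base_le_lev: assumes "t \<in> T" shows "base lev \<xi> t \<le> lev \<xi> t"
  unfolding base_def using lev_mono[OF assms] lev_nonneg[OF assms] by (intro cSup_least) auto

lemma lev_candidate:
  assumes "t \<in> T" "\<not> is_limit \<xi>"
  shows "lev \<xi> t \<in> candidates lev \<xi> t" "l \<in> candidates lev \<xi> t \<Longrightarrow> l \<le> lev \<xi> t"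
  using Sup_candidates[OF assms, OF conjunct1[OF base_candidate[OF assms all_good[OF assms(1)]]]]
  by blast+

text \<open>
  Together with \<open>lev_feas\<close>: outside limit stages the level is the greatest affordable height.
\<close>

lemma lev_maximal:
  assumes "t \<in> T" "\<not> is_limit \<xi>" "feas t (S \<xi> t l) (1 + a / 2 * l)" "l \<le> 2 / a + 1"
  shows "l \<le> lev \<xi> t"
proof (cases "base lev \<xi> t \<le> l")
  case True
  then have "l \<in> candidates lev \<xi> t" using assms unfolding candidates_def by blast
  then show ?thesis using lev_candidate(2)[OF assms(1,2)] by blast
next
  case False
  then show ?thesis using base_le_lev[OF assms(1), of \<xi>] by linarith
qed

lemma base_agree: "agree \<xi> s t \<Longrightarrow> base lev \<xi> s = base lev \<xi> t"
  unfolding base_def agree_def by (simp cong: image_cong_simp)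

text \<open>
  The decisive monotonicity: both points raise the same staircase, but the larger one has to keep it
  up on a longer segment.
\<close>

lemma lev_antimono:
  assumes "s \<sqsubseteq> t" "agree \<xi> s t"
  shows "lev \<xi> t \<le> lev \<xi> s"
proof -
  have st: "s \<in> T" "t \<in> T" using in_T assms(1) by blast+
  show ?thesis
  proof (cases "is_limit \<xi>")
    case True
    then have "lev \<xi> t = lev \<xi> s"
      using lev_unfold[of \<xi>] base_agree[OF assms(2)] unfolding step_def by metis
    then show ?thesis by simp
  next
    case False
    have "feas t (S \<xi> s (lev \<xi> t)) (1 + a / 2 * lev \<xi> t)"
      using lev_feas[OF st(2)] S_agree[OF assms(2)] by simp
    then show ?thesis
      using lev_maximal[OF st(1) False feas_mono[OF assms(1)] lev_le_top[OF st(2)]] by blast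
  qed
qed

text \<open>
  If \<open>t\<close> itself is not settled then the staircase has the value \<open>l\<close> at \<open>t\<close>, so its extensions have
  norm at least \<open>a * l\<close>, and \<open>a * l \<le> 1 + a / 2 * l\<close> means \<open>l \<le> 2 / a\<close>.
\<close>

lemma lev_small:
  assumes t: "t \<in> T" and "\<And>\<eta>. \<eta> < \<xi> \<Longrightarrow> \<not> D \<eta> t t"
  shows "lev \<xi> t \<le> 2 / a"
proof -
  let ?l = "lev \<xi> t"
  have S: "S \<xi> t ?l t = ?l" using assms(2) by (rule S_unsettled)
  have "a * ?l \<le> 1 + a / 2 * ?l + e" if e: "e > 0" for e
  proof -
    obtain f where f: "f \<in> ext t (S \<xi> t ?l)" "N f < 1 + a / 2 * ?l + e"
      using lev_feas[OF t] e unfolding feas_def by blast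
    then have "f t = ?l" "f \<in> V" using le_refl[OF t] S unfolding ext_def by auto
    then show ?thesis using N_ge[of f t] f(2) lev_nonneg[OF t, of \<xi>] by simp
  qed
  then have "a * ?l \<le> 1 + a / 2 * ?l" by (rule field_le_epsilon)
  then show ?thesis using a_pos by (simp add: field_simps)
qed

lemma lev_csuc_small: "s \<sqsubset> t \<Longrightarrow> agree (csuc \<eta>) s t \<Longrightarrow> lev (csuc \<eta>) t \<le> 2 / a"
proof (rule lev_small)
  assume st: "s \<sqsubset> t" "agree (csuc \<eta>) s t"
  then show "t \<in> T" using in_T lt_le by blast
  have "\<not> D \<eta> t t" using st unfolding D_iff by blast
  then show "\<not> D \<zeta> t t" if "\<zeta> < csuc \<eta>" for \<zeta>
    using that D_mono unfolding less_csuc_iff by blast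
qed

lemma lev_small_or_top:
  assumes t: "t \<in> T"
  shows "lev \<xi> t \<le> 2 / a \<or> lev \<xi> t = 2 / a + 1"
proof (cases "\<exists>\<eta><\<xi>. D \<eta> t t")
  case False
  then show ?thesis using lev_small[OF t] by blast
next
  case True
  then obtain \<eta> where \<eta>: "\<eta> < \<xi>" "D \<eta> t t" by blast
  have D: "D \<eta> t v" if "v \<sqsubseteq> t" for v using \<eta>(2) lt_le_trans[OF _ that] unfolding D_iff by blast
  have "feas t (S \<eta> t (lev \<eta> t)) (1 + a / 2 * (2 / a + 1))"
  proof -
    have "a / 2 * lev \<eta> t \<le> a / 2 * (2 / a + 1)"
      using lev_le_top[OF t, of \<eta>] a_pos by (intro mult_left_mono) auto
    then show ?thesis using lev_feas[OF t, of \<eta>] unfolding feas_def by (meson add_mono_thms_linordered_semiring(1) less_le_trans order_refl)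
  qed
  moreover have "S (csuc \<eta>) t (2 / a + 1) v = S \<eta> t (lev \<eta> t) v" if "v \<sqsubseteq> t" for v
    using S_settled[OF less_csuc D[OF that]] .
  ultimately have "feas t (S (csuc \<eta>) t (2 / a + 1)) (1 + a / 2 * (2 / a + 1))"
    using feas_cong[of t "S (csuc \<eta>) t (2 / a + 1)" "S \<eta> t (lev \<eta> t)"] by simp
  then have "2 / a + 1 \<le> lev (csuc \<eta>) t" using lev_maximal[OF t not_is_limit_csuc] by simp
  moreover have "csuc \<eta> \<le> \<xi>" using \<eta>(1) csuc_le_iff by blast
  ultimately show ?thesis using lev_mono[OF t, of "csuc \<eta>" \<xi>] lev_le_top[OF t, of \<xi>] by linarith
qed

text \<open>
  Unless the level is the bound \<open>2 / a + 1\<close>, the infimum of the norm over the extensions is exactly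
  \<open>1 + a / 2 * lev \<xi> s\<close>: otherwise a slightly greater height were affordable. At limit stages this
  follows from the earlier stages, since the staircases converge uniformly.
\<close>

lemma lev_optimal:
  assumes s: "s \<in> T" and "lev \<xi> s \<le> 2 / a" "f \<in> ext s (S \<xi> s (lev \<xi> s))"
  shows "1 + a / 2 * lev \<xi> s \<le> N f"
  using assms(2,3)
proof (induction \<xi> arbitrary: f rule: less_induct)
  case (less \<xi>)
  let ?l = "lev \<xi> s"
  have fV: "f \<in> V" using less.prems unfolding ext_def by blast
  show ?case
  proof (rule ccontr)
    assume "\<not> ?thesis"
    then have gap: "0 < 1 + a / 2 * ?l - N f" by simp
    show False
    proof (cases "is_limit \<xi>")
      case False
      define d where "d = min 1 ((1 + a / 2 * ?l - N f) / b)"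
      have d: "0 < d" "d \<le> 1" "b * d \<le> 1 + a / 2 * ?l - N f"
        using gap b_pos by (auto simp: d_def min_def field_simps)
      let ?g = "\<lambda>v. f v + (?l + d - ?l) * room \<xi> s v"
      have "N ?g \<le> N f + b * \<bar>?l + d - ?l\<bar>" by (rule N_shift[OF s False fV])
      also have "\<dots> \<le> 1 + a / 2 * ?l" using d by simp
      also have "\<dots> \<le> 1 + a / 2 * (?l + d)" using d a_pos by simp
      finally have "feas s (S \<xi> s (?l + d)) (1 + a / 2 * (?l + d))"
        unfolding feas_def using ext_S_shift[OF s False less.prems(2), of "?l + d"]
        by (meson less_add_same_cancel1 le_less_trans)
      moreover have "?l + d \<le> 2 / a + 1" using less.prems(1) d(2) by simp
      ultimately have "?l + d \<le> ?l" by (rule lev_maximal[OF s False])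
      then show False using d(1) by simp
    next
      case True
      define d where "d = (1 + a / 2 * ?l - N f) / (a / 2 + b)"
      have d: "0 < d" "(a / 2 + b) * d = 1 + a / 2 * ?l - N f"
        using gap a_pos b_pos unfolding d_def by (auto intro!: divide_pos_pos add_pos_pos)
      obtain \<eta> where \<eta>: "\<eta> < \<xi>" "?l - d < lev \<eta> s" using lev_limit_approx[OF s True d(1)] by blast
      have le: "lev \<eta> s \<le> ?l" using lev_mono[OF s] \<eta>(1) by simp
      have close: "\<bar>Y \<xi> s ?l v - Y \<eta> s (lev \<eta> s) v\<bar> \<le> ?l - lev \<eta> s" for v
        by (rule Y_close[OF \<eta>(1) _ le]) (use lev_mono[OF s] in auto)
      let ?h = "\<lambda>v. Y \<eta> s (lev \<eta> s) v - Y \<xi> s ?l v"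
      have h: "?h \<in> V" using V_diff[OF lev_Y_in_V[OF s] lev_Y_in_V[OF s]] .
      have "(\<lambda>v. f v + ?h v) \<in> ext s (S \<eta> s (lev \<eta> s))"
        by (rule ext_shift[OF less.prems(2) h]) (auto simp: Y_def)
      then have "1 + a / 2 * lev \<eta> s \<le> N (\<lambda>v. f v + ?h v)"
        using less.IH[OF \<eta>(1)] le less.prems(1) by simp
      also have "\<dots> \<le> N f + b * (?l - lev \<eta> s)"
        by (rule N_near[OF V_add[OF fV h] fV]) (use close in \<open>simp add: abs_minus_commute\<close>)
      finally have *: "1 + a / 2 * lev \<eta> s \<le> N f + b * (?l - lev \<eta> s)" .
      have "(a / 2 + b) * (?l - lev \<eta> s) < (a / 2 + b) * d"
        using \<eta>(2) a_pos b_pos by (intro mult_strict_left_mono) auto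
      then show False using * d(2) by (simp add: algebra_simps)
    qed
  qed
qed

text \<open>
  The only place where the smoothness of the norm is used.
\<close>

lemma not_attained:
  assumes t: "t \<in> T" and stop: "lev (csuc \<beta>) t = lev \<beta> t" and small: "lev \<beta> t \<le> 2 / a"
    and f: "f \<in> ext t (S \<beta> t (lev \<beta> t))"
  shows "1 + a / 2 * lev \<beta> t < N f"
proof (rule ccontr)
  let ?l = "lev \<beta> t" let ?m = "1 + a / 2 * lev \<beta> t"
  assume "\<not> ?m < N f"
  then have Nf: "N f \<le> ?m" by simp
  have fV: "f \<in> V" using f unfolding ext_def by blast
  obtain s where s: "s \<sqsubseteq> t" "agree (csuc \<beta>) s t" "room (csuc \<beta>) t = (\<lambda>v. ind t v - ind s v)"
    by (rule room_csuc[OF t, of \<beta>])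
  let ?h = "room (csuc \<beta>) t"
  have hV: "?h \<in> V" using room_in_V[OF t not_is_limit_csuc] .
  have sT: "s \<in> T" using in_T s(1) by blast
  have agree: "agree \<beta> s t" "lev \<beta> s = ?l"
    using s(2) less_csuc unfolding agree_csuc by (auto simp: agree_def)
  have fs: "f \<in> ext s (S \<beta> s ?l)" using f ext_mono[OF s(1)] S_agree[OF agree(1)] by auto
  \<comment> \<open>\<open>f + e * ?h\<close> still extends the staircase of \<open>s\<close>, since \<open>?h\<close> lives on \<open>(s,t]\<close>\<close>
  have lower: "?m \<le> N (\<lambda>v. f v + e * ?h v)" for e
  proof -
    have "?h v = 0" if "v \<sqsubseteq> s \<or> \<not> s \<sqsubseteq> v" for v
      using that le_trans[of v s t] le_linear[of v t s] lt_le[of s v] s(1)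
      unfolding s(3) ind_def by auto
    then have "(\<lambda>v. f v + e * ?h v) \<in> ext s (S \<beta> s (lev \<beta> s))"
      using V_add[OF fV V_scale[OF hV]] fs unfolding ext_def agree by simp
    then show ?thesis using lev_optimal[OF sT] agree(2) small by metis
  qed
  have Nfm: "N f = ?m" using lower[of 0] Nf by simp
  have "f \<noteq> (\<lambda>v. 0)"
  proof
    assume "f = (\<lambda>v. 0)"
    then have "N f \<le> 0" using N_le[OF V_zero, of 0] by simp
    moreover have "0 \<le> a / 2 * ?l" using lev_nonneg[OF t, of \<beta>] a_pos by simp
    ultimately show False using Nfm by linarith
  qed
  then obtain L where L: "((\<lambda>c. (N (\<lambda>v. f v + c * ?h v) - N f) / c) \<longlongrightarrow> L) (at 0)"
    using smooth fV hV unfolding Gateaux_smooth_on_def by blast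
  \<comment> \<open>the difference quotients at negative \<open>c\<close> are non-positive\<close>
  have "L \<le> 0"
  proof (rule tendsto_upperbound)
    show "((\<lambda>c. (N (\<lambda>v. f v + c * ?h v) - N f) / c) \<longlongrightarrow> L) (at_left 0)"
      using L by (rule tendsto_within_subset) simp
    show "\<forall>\<^sub>F c in at_left 0. (N (\<lambda>v. f v + c * ?h v) - N f) / c \<le> 0"
      using lower Nfm by (auto simp: eventually_at_filter divide_nonneg_neg)
  qed simp
  then have "L < a / 2" using a_pos by linarith
  have "((\<lambda>c. (N (\<lambda>v. f v + c * ?h v) - N f) / c) \<longlongrightarrow> L) (at_right 0)"
    using L by (rule tendsto_within_subset) simp
  then have "\<forall>\<^sub>F c in at_right 0. (N (\<lambda>v. f v + c * ?h v) - N f) / c < a / 2"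
    using \<open>L < a / 2\<close> by (rule order_tendstoD(2))
  moreover have "\<forall>\<^sub>F c in at_right (0::real). 0 < c \<and> c < 1"
    unfolding eventually_at_right[OF zero_less_one] by (intro exI[of _ 1]) auto
  ultimately have "\<forall>\<^sub>F c in at_right 0. (N (\<lambda>v. f v + c * ?h v) - N f) / c < a / 2 \<and> 0 < c \<and> c < 1"
    by (rule eventually_conj)
  then obtain e where e: "(N (\<lambda>v. f v + e * ?h v) - N f) / e < a / 2" "0 < e" "e < 1"
    using eventually_happens'[OF trivial_limit_at_right_real] by blast
  have "N (\<lambda>v. f v + e * ?h v) < 1 + a / 2 * (?l + e)"
    using e Nfm by (simp add: field_simps)
  moreover have "(\<lambda>v. f v + e * ?h v) \<in> ext t (S (csuc \<beta>) t (?l + e))"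
  proof -
    have "f \<in> ext t (S (csuc \<beta>) t ?l)" using f ext_cong[OF S_csuc_base] by simp
    then show ?thesis using ext_S_shift[OF t not_is_limit_csuc, of f \<beta> ?l "?l + e"] by simp
  qed
  ultimately have "feas t (S (csuc \<beta>) t (?l + e)) (1 + a / 2 * (?l + e))"
    unfolding feas_def by (meson less_add_same_cancel1 order_less_trans)
  then have "?l + e \<le> lev (csuc \<beta>) t"
    using lev_maximal[OF t not_is_limit_csuc] small e(3) by simp
  then show False using stop e(2) by simp
qed

end

section \<open>The map into the order Z\<close>

text \<open>The element of \<open>Z\<close> with the terms \<open>f \<xi>\<close> for \<open>\<xi> \<le> \<beta>\<close>.\<close>

definition seqZ :: "cord \<Rightarrow> (cord \<Rightarrow> real) \<Rightarrow> Z"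
  where "seqZ \<beta> f = Abs_Z (\<lambda>\<xi>. if \<xi> \<le> \<beta> then Some (f \<xi>) else None)"

text \<open>
  The sequence \<open>f\<close> restricted to \<open>{..\<beta>}\<close> belongs to \<open>Z\<close>, with continuity expressed at limit ordinals
  (compare \<open>continuous_on_mono_cord\<close>).
\<close>

definition Zseq :: "cord \<Rightarrow> (cord \<Rightarrow> real) \<Rightarrow> bool"
  where "Zseq \<beta> f \<longleftrightarrow> (\<forall>\<eta> \<xi>. \<eta> < \<xi> \<and> \<xi> \<le> \<beta> \<longrightarrow> f \<eta> \<le> f \<xi>) \<and>
    (\<forall>\<eta> \<xi>. \<eta> < \<xi> \<and> \<xi> < \<beta> \<longrightarrow> f \<eta> < f \<xi>) \<and>
    (\<forall>\<xi>\<le>\<beta>. is_limit \<xi> \<longrightarrow> (\<forall>e>0. \<exists>\<eta><\<xi>. f \<xi> - e < f \<eta>))"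

lemma Rep_seqZ:
  assumes "Zseq \<beta> f"
  shows "Rep_Z (seqZ \<beta> f) = (\<lambda>\<xi>. if \<xi> \<le> \<beta> then Some (f \<xi>) else None)"
proof -
  let ?x = "\<lambda>\<xi>. if \<xi> \<le> \<beta> then Some (f \<xi>) else None"
  have dom: "dom ?x = {..\<beta>}" by (auto split: if_splits)
  have eq: "(the \<circ> ?x) \<xi> = f \<xi>" if "\<xi> \<in> {..\<beta>}" for \<xi> using that by simp
  have mono: "mono_on {..\<beta>} f"
    unfolding mono_on_def
  proof (intro allI impI)
    fix \<eta> \<xi> assume "\<eta> \<in> {..\<beta>} \<and> \<xi> \<in> {..\<beta>} \<and> \<eta> \<le> \<xi>"
    then show "f \<eta> \<le> f \<xi>" using assms unfolding Zseq_def by (cases "\<eta> = \<xi>") auto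
  qed
  have cont: "continuous_on {..\<beta>} f"
  proof (rule continuous_on_mono_cord[OF mono])
    fix \<xi> e assume "\<xi> \<le> \<beta>" "is_limit \<xi>" "(0::real) < e"
    then show "\<exists>\<eta><\<xi>. f \<xi> - e < f \<eta>" using assms unfolding Zseq_def by blast
  qed
  have "mono_on {..\<beta>} (the \<circ> ?x)" 
    unfolding mono_on_def
  proof (intro allI impI)
    fix \<eta> \<xi> assume *: "\<eta> \<in> {..\<beta>} \<and> \<xi> \<in> {..\<beta>} \<and> \<eta> \<le> \<xi>"
    then have "f \<eta> \<le> f \<xi>" using mono_onD[OF mono, of \<eta> \<xi>] by blast
    then show "(the \<circ> ?x) \<eta> \<le> (the \<circ> ?x) \<xi>" using * eq by simp
  qed
  moreover have "continuous_on {..\<beta>} (the \<circ> ?x)"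
    by (rule continuous_on_cong[THEN iffD1, OF refl _ cont]) (simp add: eq)
  moreover have "strict_mono_on {..<\<beta>} (the \<circ> ?x)"
    unfolding strict_mono_on_def using assms unfolding Zseq_def by auto
  ultimately have "?x \<in> {x. \<exists>\<beta>. dom x = {..\<beta>} \<and> mono_on {..\<beta>} (the \<circ> x) \<and>
      continuous_on {..\<beta>} (the \<circ> x) \<and> strict_mono_on {..<\<beta>} (the \<circ> x)}"
    unfolding mem_Collect_eq by (intro exI[of _ \<beta>] conjI dom)
  then show ?thesis unfolding seqZ_def by (rule Abs_Z_inverse)
qed

lemma seqZ_less:
  assumes "Zseq \<beta> f" "Zseq \<gamma> g" "\<alpha> \<le> \<beta>" "\<alpha> \<le> \<gamma>" "\<And>\<eta>. \<eta> < \<alpha> \<Longrightarrow> f \<eta> = g \<eta>" "g \<alpha> < f \<alpha>"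
  shows "seqZ \<beta> f < seqZ \<gamma> g"
proof -
  have "\<forall>\<xi><\<alpha>. Rep_Z (seqZ \<beta> f) \<xi> = Rep_Z (seqZ \<gamma> g) \<xi>"
    unfolding Rep_seqZ[OF assms(1)] Rep_seqZ[OF assms(2)] using assms(3-5) by auto
  moreover have "\<alpha> \<in> dom (Rep_Z (seqZ \<beta> f)) \<inter> dom (Rep_Z (seqZ \<gamma> g))"
    unfolding Rep_seqZ[OF assms(1)] Rep_seqZ[OF assms(2)] using assms(3,4) by auto
  moreover have "the (Rep_Z (seqZ \<gamma> g) \<alpha>) < the (Rep_Z (seqZ \<beta> f) \<alpha>)"
    unfolding Rep_seqZ[OF assms(1)] Rep_seqZ[OF assms(2)] using assms(3,4,6) by auto
  ultimately show ?thesis unfolding less_Z_def by blast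
qed

lemma seqZ_eqD:
  assumes "Zseq \<beta> f" "Zseq \<gamma> g" "seqZ \<beta> f = seqZ \<gamma> g"
  shows "\<beta> = \<gamma>" "\<xi> \<le> \<beta> \<Longrightarrow> f \<xi> = g \<xi>"
proof -
  have R: "(\<lambda>\<xi>. if \<xi> \<le> \<beta> then Some (f \<xi>) else None) = (\<lambda>\<xi>. if \<xi> \<le> \<gamma> then Some (g \<xi>) else None)"
    using assms(3) Rep_seqZ[OF assms(1)] Rep_seqZ[OF assms(2)] by simp
  have "\<gamma> \<ge> \<beta>" using fun_cong[OF R, of \<beta>] by (auto split: if_splits)
  moreover have "\<beta> \<ge> \<gamma>" using fun_cong[OF R, of \<gamma>] by (auto split: if_splits)
  ultimately show "\<beta> = \<gamma>" by simp
  then show "f \<xi> = g \<xi>" if "\<xi> \<le> \<beta>" using fun_cong[OF R, of \<xi>] that by auto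
qed

context renormed_tree
begin

text \<open>The first stage whose level is repeated at the next stage.\<close>

definition stop :: "'a \<Rightarrow> cord"
  where "stop t = (LEAST \<xi>. lev (csuc \<xi>) t = lev \<xi> t)"

text \<open>
  The sequence of levels, including the repeated last value. This last term makes \<open>rho s < rho t\<close> when
  \<open>s\<close> continues to climb at a stage at which \<open>t\<close> above it gets stuck.
\<close>

definition rho :: "'a \<Rightarrow> Z"
  where "rho t = seqZ (csuc (stop t)) (\<lambda>\<xi>. lev \<xi> t)"

lemma lev_stop: assumes "t \<in> T" shows "lev (csuc (stop t)) t = lev (stop t) t"
proof -
  have "\<exists>\<xi>. lev (csuc \<xi>) t = lev \<xi> t"
    by (rule cord_real_mono_stationary[of "\<lambda>\<xi>. lev \<xi> t"])
      (rule lev_mono[OF assms less_imp_le])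
  then show ?thesis unfolding stop_def by (rule LeastI_ex)
qed

lemma lev_strict: assumes t: "t \<in> T" and "\<eta> < \<xi>" "\<xi> \<le> stop t" shows "lev \<eta> t < lev \<xi> t"
proof -
  have "\<eta> < stop t" using assms by simp
  then have "lev (csuc \<eta>) t \<noteq> lev \<eta> t" unfolding stop_def by (rule not_less_Least)
  moreover have "lev \<eta> t \<le> lev (csuc \<eta>) t" using lev_mono[OF t less_imp_le[OF less_csuc]] .
  moreover have "lev (csuc \<eta>) t \<le> lev \<xi> t" using lev_mono[OF t] csuc_le_iff assms(2) by blast
  ultimately show ?thesis by linarith
qed

lemma Zseq_lev: assumes t: "t \<in> T" shows "Zseq (csuc (stop t)) (\<lambda>\<xi>. lev \<xi> t)"
  unfolding Zseq_def
proof (intro conjI)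
  show "\<forall>\<eta> \<xi>. \<eta> < \<xi> \<and> \<xi> \<le> csuc (stop t) \<longrightarrow> lev \<eta> t \<le> lev \<xi> t"
    using lev_mono[OF t less_imp_le] by blast
  show "\<forall>\<eta> \<xi>. \<eta> < \<xi> \<and> \<xi> < csuc (stop t) \<longrightarrow> lev \<eta> t < lev \<xi> t"
    unfolding less_csuc_iff using lev_strict[OF t] by blast
  show "\<forall>\<xi>\<le>csuc (stop t). is_limit \<xi> \<longrightarrow> (\<forall>e>0. \<exists>\<eta><\<xi>. lev \<xi> t - e < lev \<eta> t)"
    using lev_limit_approx[OF t] by blast
qed

lemma rho_less:
  assumes "s \<in> T" "t \<in> T" "\<alpha> \<le> csuc (stop s)" "\<alpha> \<le> csuc (stop t)" "agree \<alpha> s t" "lev \<alpha> t < lev \<alpha> s"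
  shows "rho s < rho t"
  unfolding rho_def
  by (rule seqZ_less[OF Zseq_lev[OF assms(1)] Zseq_lev[OF assms(2)] assms(3,4) _ assms(6)])
    (use assms(5) in \<open>simp add: agree_def\<close>)

lemma rho_eqD:
  assumes "s \<in> T" "t \<in> T" "rho s = rho t"
  shows "stop s = stop t" "\<xi> \<le> csuc (stop s) \<Longrightarrow> lev \<xi> s = lev \<xi> t"
proof -
  note eq = seqZ_eqD[OF Zseq_lev[OF assms(1)] Zseq_lev[OF assms(2)] assms(3)[unfolded rho_def]]
  show "\<xi> \<le> csuc (stop s) \<Longrightarrow> lev \<xi> s = lev \<xi> t" by (rule eq(2))
  show "stop s = stop t"
  proof (rule order.antisym)
    show "stop s \<le> stop t" "stop t \<le> stop s"
      using less_csuc[of "stop s"] less_csuc[of "stop t"] eq(1) less_csuc_iff by metis+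
  qed
qed

lemma stop_agree:
  assumes "s \<in> T" "t \<in> T" "agree (csuc (csuc (stop s))) s t"
  shows "stop t = stop s"
  unfolding stop_def[of t]
proof (rule Least_equality)
  have eq: "lev \<xi> s = lev \<xi> t" if "\<xi> \<le> csuc (stop s)" for \<xi> using assms(3) that unfolding agree_csuc by blast
  show "lev (csuc (stop s)) t = lev (stop s) t"
    using lev_stop[OF assms(1)] eq[OF less_imp_le[OF less_csuc]] eq[OF order_refl] by argo
  fix y assume y: "lev (csuc y) t = lev y t"
  show "stop s \<le> y"
  proof (rule ccontr)
    assume "\<not> stop s \<le> y"
    then have less: "y < stop s" by simp
    then have "csuc y \<le> stop s" by (simp add: csuc_le_iff)
    then have le: "y \<le> csuc (stop s)" "csuc y \<le> csuc (stop s)"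
      using less less_csuc[of "stop s"] by auto
    have "lev (csuc y) s = lev y s" using y eq[OF le(1)] eq[OF le(2)] by argo
    then show False using less not_less_Least[of y "\<lambda>\<xi>. lev (csuc \<xi>) s = lev \<xi> s"] unfolding stop_def by blast
  qed
qed

text \<open>
  Along a branch two sequences either coincide or differ for the first time within both domains,
  and then the sequence of the larger point has the smaller entry.
\<close>

lemma rho_compare:
  assumes st: "s \<sqsubseteq> t"
  obtains (same) "rho s = rho t" | (less) \<alpha> where "\<alpha> \<le> csuc (stop s)" "\<alpha> \<le> csuc (stop t)" "agree \<alpha> s t" "lev \<alpha> t < lev \<alpha> s"
proof -
  have T: "s \<in> T" "t \<in> T" using in_T st by blast+
  show ?thesis
  proof (cases "agree (csuc (csuc (stop s))) s t")
    case True
    have "stop t = stop s" by (rule stop_agree[OF T True])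
    moreover have "(\<lambda>\<xi>. if \<xi> \<le> csuc (stop s) then Some (lev \<xi> s) else None)
      = (\<lambda>\<xi>. if \<xi> \<le> csuc (stop s) then Some (lev \<xi> t) else None)"
      using True unfolding agree_csuc by auto
    ultimately have "rho s = rho t" unfolding rho_def seqZ_def by simp
    then show ?thesis by (rule same)
  next
    case False
    then obtain \<xi> where \<xi>: "\<xi> \<le> csuc (stop s)" "lev \<xi> s \<noteq> lev \<xi> t" unfolding agree_csuc by blast
    define \<alpha> where "\<alpha> = (LEAST \<xi>. lev \<xi> s \<noteq> lev \<xi> t)"
    have ne: "lev \<alpha> s \<noteq> lev \<alpha> t" unfolding \<alpha>_def using \<xi>(2) by (rule LeastI)
    have "\<alpha> \<le> \<xi>" unfolding \<alpha>_def using \<xi>(2) by (rule Least_le)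
    then have le: "\<alpha> \<le> csuc (stop s)" using \<xi>(1) by (rule order_trans)
    have agree: "agree \<alpha> s t" unfolding agree_def \<alpha>_def using not_less_Least by blast
    have less: "lev \<alpha> t < lev \<alpha> s" using lev_antimono[OF st agree] ne by simp
    have "\<alpha> \<le> csuc (stop t)"
    proof (rule ccontr)
      assume *: "\<not> \<alpha> \<le> csuc (stop t)"
      then have "csuc (csuc (stop t)) \<le> \<alpha>" by (simp add: csuc_le_iff)
      then have "agree (csuc (csuc (stop t))) t s" using agree unfolding agree_def by auto
      then have "stop s = stop t" by (rule stop_agree[OF T(2,1)])
      then show False using * le by simp
    qed
    then show ?thesis using that(2) le agree less by blast
  qed
qed

lemma rho_increasing: "increasing_on T r rho"
  unfolding increasing_on_def
proof (rule monotone_onI)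
  fix s t assume st: "s \<in> T" "t \<in> T" "s \<sqsubset> t"
  show "rho s \<le> rho t"
    by (rule rho_compare[OF lt_le[OF st(3)]]) (auto dest: rho_less[OF st(1,2)])
qed

text \<open>
  On the part of the branch that is not settled before stage \<open>\<alpha>\<close>, the staircase of a later stage takes
  values between the two levels.
\<close>

lemma stair_final_bounds:
  assumes "t \<in> T" "\<alpha> \<le> \<beta>" "\<And>\<eta>. \<eta> < \<alpha> \<Longrightarrow> \<not> D \<eta> t v"
  shows "lev \<alpha> t \<le> S \<beta> t (lev \<beta> t) v \<and> S \<beta> t (lev \<beta> t) v \<le> lev \<beta> t"
proof (cases "\<alpha> = \<beta>")
  case True
  then show ?thesis using S_unsettled[of \<beta> t v] assms(3) by simp
next
  case False
  then have less: "\<alpha> < \<beta>" using assms(2) by simp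
  show ?thesis
  proof (cases "D \<alpha> t v")
    case True
    then show ?thesis
      using S_settled[OF less] S_unsettled[OF assms(3), of \<alpha>] lev_mono[OF assms(1,2)] by simp
  next
    case False
    then show ?thesis
      using S_bounds[of \<alpha> \<beta> t "lev \<beta> t" v] lev_mono[OF assms(1)] assms(2) by simp
  qed
qed

lemma near_optimal_bound:
  assumes "f \<in> ext t g" "N f < 1 + a / 2 * l + e" "l \<le> 2 / a" "e \<le> 1"
  shows "\<bar>f v\<bar> \<le> 3 / a"
proof -
  have "f \<in> V" using assms(1) unfolding ext_def by blast
  then have "a * \<bar>f v\<bar> \<le> N f" by (rule N_ge)
  moreover have "a / 2 * l \<le> 1" using assms(3) a_pos by (simp add: field_simps)
  ultimately have "a * \<bar>f v\<bar> \<le> 3" using assms(2,4) by linarith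
  then show ?thesis using a_pos by (simp add: field_simps)
qed

end

section \<open>No bad points\<close>

context renormed_tree
begin

lemma N_sum_le:
  assumes "finite A" "\<And>i. i \<in> A \<Longrightarrow> f i \<in> V" "\<And>i. i \<in> A \<Longrightarrow> N (f i) \<le> K"
  shows "N (\<lambda>v. \<Sum>i\<in>A. f i v) \<le> real (card A) * K"
  using assms
proof (induction A rule: finite_induct)
  case empty
  show ?case using N_le[OF V_zero, of 0] by simp
next
  case (insert i A)
  have "N (\<lambda>v. f i v + (\<Sum>i\<in>A. f i v)) \<le> N (f i) + N (\<lambda>v. \<Sum>i\<in>A. f i v)"
    using insert.prems(1) by (intro N_triangle V_sum) auto
  moreover have "N (\<lambda>v. \<Sum>i\<in>A. f i v) \<le> real (card A) * K" using insert by blast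
  moreover have "N (f i) \<le> K" using insert.prems(2) by blast
  ultimately show ?case using insert.hyps by (simp add: algebra_simps)
qed

lemma successors_disjoint:
  assumes "u \<in> immediate_successors T r t" "u' \<in> immediate_successors T r t" "u \<noteq> u'"
  shows "\<not> (u \<sqsubseteq> v \<and> u' \<sqsubseteq> v)"
proof
  assume "u \<sqsubseteq> v \<and> u' \<sqsubseteq> v"
  then have "u \<sqsubset> u' \<or> u' \<sqsubset> u" using le_linear[of u v u'] assms(3) unfolding tree_less_def by blast
  then show False using assms unfolding immediate_successors_def by blast
qed

lemma below_successor:
  assumes u: "u \<in> immediate_successors T r t" and v: "v \<sqsubseteq> u" "\<not> v \<sqsubseteq> t"
  shows "v = u"
proof -
  have "t \<sqsubseteq> u" using u lt_le unfolding immediate_successors_def by blast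
  then have "t \<sqsubset> v" using le_linear[OF v(1), of t] v(2) by blast
  then show ?thesis using u v(1) in_T(1)[OF v(1)] unfolding immediate_successors_def tree_less_def by blast
qed

text \<open>
  Functions that are close to the staircase of \<open>t\<close> on \<open>(0,t]\<close> and whose remaining parts are uniformly
  bounded and supported above distinct immediate successors of \<open>t\<close> have averages close to the staircase
  extended by zero.
\<close>

lemma average_near:
  assumes t: "t \<in> T" and \<beta>: "lev \<beta> t \<le> 2 / a" and e: "0 < e" "e \<le> 1"
    and u: "inj (u :: nat \<Rightarrow> 'a)" "range u \<subseteq> immediate_successors T r t"
    and f: "\<And>n. f n \<in> ext (u n) (g n)" "\<And>n v. v \<sqsubseteq> t \<Longrightarrow> \<bar>f n v - Y \<beta> t (lev \<beta> t) v\<bar> \<le> e"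
      "\<And>n. N (f n) < 1 + a / 2 * lev \<beta> t + e"
  shows "N (Y \<beta> t (lev \<beta> t)) \<le> 1 + a / 2 * lev \<beta> t + e + b * e"
proof -
  let ?F0 = "Y \<beta> t (lev \<beta> t)"
  \<comment> \<open>\<open>3 / a\<close> bounds all \<open>f n\<close>, by \<open>near_optimal_bound\<close>\<close>
  obtain k :: nat where k: "3 / a / e < real k" using reals_Archimedean2 by blast
  have k0: "0 < real k" using k a_pos e by (meson divide_pos_pos less_trans zero_less_numeral)
  have fV: "f n \<in> V" for n using f(1) unfolding ext_def by blast
  define F where "F = (\<lambda>v. 1 / real k * (\<Sum>n<k. f n v))"
  have FV: "F \<in> V" unfolding F_def using fV by (intro V_scale V_sum)
  have "N F = 1 / real k * N (\<lambda>v. \<Sum>n<k. f n v)"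
    unfolding F_def using N_scale[OF V_sum[OF fV], of "1 / real k"] k0 by simp
  also have "\<dots> \<le> 1 / real k * (real (card {..<k}) * (1 + a / 2 * lev \<beta> t + e))"
    using fV f(3) k0 by (intro mult_left_mono N_sum_le) (auto simp: less_imp_le)
  finally have NF: "N F \<le> 1 + a / 2 * lev \<beta> t + e" using k0 by simp
  have "\<bar>?F0 v - F v\<bar> \<le> e" for v
  proof (cases "v \<sqsubseteq> t")
    case True
    have "real k * (?F0 v - F v) = - (\<Sum>n<k. f n v - ?F0 v)"
      unfolding F_def using k0 by (simp add: algebra_simps sum_subtractf)
    then have "real k * \<bar>?F0 v - F v\<bar> = \<bar>\<Sum>n<k. f n v - ?F0 v\<bar>" using k0 by (metis abs_minus_cancel abs_mult abs_of_pos)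
    also have "\<dots> \<le> (\<Sum>n<k. e)" by (rule order_trans[OF sum_abs sum_mono]) (rule f(2)[OF True])
    finally show ?thesis using k0 by simp
  next
    case False
    then have Zv: "?F0 v = 0" unfolding Y_def by simp
    have above: "u n \<sqsubseteq> v" if "f n v \<noteq> 0" for n
    proof -
      have "v \<sqsubseteq> u n \<or> u n \<sqsubseteq> v" using that f(1)[of n] unfolding ext_def by blast
      then show ?thesis using below_successor[of "u n" t v] u(2) False by blast
    qed
    have bound: "\<bar>f n v\<bar> \<le> 3 / a" for n using near_optimal_bound[OF f(1) f(3) \<beta> e(2)] .
    have "\<bar>\<Sum>n<k. f n v\<bar> \<le> 3 / a"
    proof (cases "\<exists>n<k. f n v \<noteq> 0")
      case True
      then obtain m where m: "m < k" "f m v \<noteq> 0" by blast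
      have "f n v = 0" if "n \<noteq> m" for n
      proof (rule ccontr)
        assume "f n v \<noteq> 0"
        then show False
          using above[OF m(2)] above[of n] successors_disjoint[of "u n" t "u m" v] u that
          by (meson injD range_subsetD)
      qed
      then have "(\<Sum>n<k. f n v) = (\<Sum>n\<in>{m}. f n v)" using m by (intro sum.mono_neutral_right) auto
      then show ?thesis using bound[of m] by simp
    next
      case False
      then show ?thesis using a_pos by simp
    qed
    then have "real k * \<bar>F v\<bar> \<le> 3 / a" unfolding F_def using k0 by (simp add: abs_mult)
    also have "\<dots> \<le> real k * e" using iffD1[OF pos_divide_less_eq[OF e(1)] k] by (simp add: mult.commute)
    finally show ?thesis using Zv k0 by simp
  qed
  then have "N ?F0 \<le> N F + b * e" by (intro N_near lev_Y_in_V[OF t] FV)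
  then show ?thesis using NF by linarith
qed

text \<open>
  Convergence of \<open>rho (u n)\<close> to \<open>rho t\<close> in the order of \<open>Z\<close> is tested against an upper neighbour
  of \<open>rho t\<close> which agrees with it up to a successor stage and is then slightly smaller.
\<close>

lemma rho_tendsto_lev_near:
  assumes t: "t \<in> T" and u: "\<And>n. t \<sqsubset> u n" and conv: "(\<lambda>n. rho (u n)) \<longlonglongrightarrow> rho t" and e: "e > 0"
  shows "\<forall>\<^sub>F n in sequentially. \<exists>\<alpha>\<le>stop t. agree \<alpha> (u n) t \<and>
    lev \<alpha> (u n) \<le> lev \<alpha> t \<and> lev (stop t) t - e \<le> lev \<alpha> (u n)"
proof -
  let ?\<beta> = "stop t" let ?l = "lev (stop t) t"
  obtain \<alpha>0 where \<alpha>0: "\<alpha>0 \<le> ?\<beta>" "\<not> is_limit \<alpha>0" "?l - e < lev \<alpha>0 t"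
  proof (cases "is_limit ?\<beta>")
    case False
    then show ?thesis using that[of ?\<beta>] e by simp
  next
    case True
    then obtain \<eta> where \<eta>: "\<eta> < ?\<beta>" "?l - e < lev \<eta> t" using lev_limit_approx[OF t True e] by blast
    have "lev \<eta> t \<le> lev (csuc \<eta>) t" using lev_mono[OF t less_imp_le[OF less_csuc]] .
    then show ?thesis using that[of "csuc \<eta>"] \<eta> not_is_limit_csuc by (simp add: csuc_le_iff)
  qed
  obtain v0 where v0: "?l - e \<le> v0" "v0 < lev \<alpha>0 t" "\<And>\<eta>. \<eta> < \<alpha>0 \<Longrightarrow> lev \<eta> t \<le> v0"
  proof (cases \<alpha>0 rule: cord_cases)
    case zero
    then show ?thesis using that[of "?l - e"] \<alpha>0 by simp
  next
    case (suc \<eta>)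
    have "lev \<eta> t < lev \<alpha>0 t" using lev_strict[OF t _ \<alpha>0(1)] less_csuc[of \<eta>] unfolding suc .
    moreover have "lev \<zeta> t \<le> lev \<eta> t" if "\<zeta> < \<alpha>0" for \<zeta>
      using that lev_mono[OF t, of \<zeta> \<eta>] unfolding suc less_csuc_iff by blast
    ultimately show ?thesis using that[of "max (?l - e) (lev \<eta> t)"] \<alpha>0(3) by (simp add: le_max_iff_disj)
  qed (use \<alpha>0 in simp)
  define y where "y = (\<lambda>\<xi>. if \<xi> < \<alpha>0 then lev \<xi> t else v0)"
  have y: "Zseq \<alpha>0 y"
    unfolding Zseq_def
  proof (intro conjI allI impI)
    show "y \<eta> \<le> y \<xi>" if "\<eta> < \<xi> \<and> \<xi> \<le> \<alpha>0" for \<eta> \<xi>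
      using that v0(3)[of \<eta>] lev_mono[OF t, of \<eta> \<xi>] unfolding y_def by auto
    show "y \<eta> < y \<xi>" if "\<eta> < \<xi> \<and> \<xi> < \<alpha>0" for \<eta> \<xi>
      using that lev_strict[OF t, of \<eta> \<xi>] \<alpha>0(1) unfolding y_def by auto
    fix \<xi> d assume \<xi>: "\<xi> \<le> \<alpha>0" "is_limit \<xi>" "(0::real) < d"
    then have less: "\<xi> < \<alpha>0" using \<alpha>0(2) by (metis order_le_less)
    obtain \<eta> where "\<eta> < \<xi>" "lev \<xi> t - d < lev \<eta> t" using lev_limit_approx[OF t \<xi>(2,3)] by blast
    then show "\<exists>\<eta><\<xi>. y \<xi> - d < y \<eta>" using less unfolding y_def by (intro exI[of _ \<eta>]) auto
  qed
  have le: "\<alpha>0 \<le> csuc ?\<beta>" using \<alpha>0(1) less_csuc[of ?\<beta>] by simp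
  have "rho t < seqZ \<alpha>0 y"
    unfolding rho_def by (rule seqZ_less[OF Zseq_lev[OF t] y le order_refl]) (auto simp: y_def v0(2))
  then have "\<forall>\<^sub>F n in sequentially. rho (u n) < seqZ \<alpha>0 y" by (rule order_tendstoD(2)[OF conv])
  then show ?thesis
  proof (rule eventually_mono)
    fix n assume less: "rho (u n) < seqZ \<alpha>0 y"
    have tu: "t \<sqsubseteq> u n" using lt_le[OF u] .
    then have uT: "u n \<in> T" by (rule in_T(2))
    show "\<exists>\<alpha>\<le>?\<beta>. agree \<alpha> (u n) t \<and> lev \<alpha> (u n) \<le> lev \<alpha> t \<and> ?l - e \<le> lev \<alpha> (u n)"
    proof (rule rho_compare[OF tu])
      assume "rho t = rho (u n)"
      then have eq: "lev \<xi> t = lev \<xi> (u n)" if "\<xi> \<le> csuc ?\<beta>" for \<xi> using rho_eqD(2)[OF t uT] that by blast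
      have "\<xi> \<le> csuc ?\<beta>" if "\<xi> \<le> ?\<beta>" for \<xi> using that less_csuc[of ?\<beta>] by simp
      then have "lev \<xi> (u n) = lev \<xi> t" if "\<xi> \<le> ?\<beta>" for \<xi> using eq[of \<xi>] that by metis
      then show ?thesis using e by (intro exI[of _ ?\<beta>]) (simp add: agree_def)
    next
      fix \<alpha> assume \<alpha>: "\<alpha> \<le> csuc ?\<beta>" "\<alpha> \<le> csuc (stop (u n))" "agree \<alpha> t (u n)" "lev \<alpha> (u n) < lev \<alpha> t"
      have "\<alpha> \<noteq> csuc ?\<beta>"
      proof
        assume *: "\<alpha> = csuc ?\<beta>"
        then have "lev ?\<beta> t = lev ?\<beta> (u n)" using \<alpha>(3) unfolding * agree_csuc by simp
        moreover have "lev ?\<beta> (u n) \<le> lev \<alpha> (u n)" unfolding * using lev_mono[OF uT less_imp_le[OF less_csuc]] .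
        ultimately show False using \<alpha>(4) lev_stop[OF t] * by simp
      qed
      then have "\<alpha> < csuc ?\<beta>" using \<alpha>(1) by (rule order.not_eq_order_implies_strict)
      then have \<alpha>\<beta>: "\<alpha> \<le> ?\<beta>" unfolding less_csuc_iff .
      have not_less: "\<not> seqZ \<alpha>0 y < rho (u n)" using less by simp
      have "?l - e \<le> lev \<alpha> (u n)"
      proof (cases \<alpha> \<alpha>0 rule: linorder_cases)
        case less
        have "seqZ \<alpha>0 y < rho (u n)"
          unfolding rho_def
          by (rule seqZ_less[OF y Zseq_lev[OF uT], of \<alpha>])
            (use less \<alpha> in \<open>auto simp: y_def agree_def\<close>)
        then show ?thesis using not_less by blast
      next
        case equal
        have "v0 \<le> lev \<alpha> (u n)"
        proof (rule ccontr)
          assume *: "\<not> v0 \<le> lev \<alpha> (u n)"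
          have "seqZ \<alpha>0 y < rho (u n)"
            unfolding rho_def
            by (rule seqZ_less[OF y Zseq_lev[OF uT], of \<alpha>])
              (use equal * \<alpha> in \<open>auto simp: y_def agree_def\<close>)
          then show False using not_less by blast
        qed
        then show ?thesis using v0(1) by linarith
      next
        case greater
        have "lev \<alpha>0 t = lev \<alpha>0 (u n)" using \<alpha>(3) greater unfolding agree_def by blast
        moreover have "lev \<alpha>0 (u n) \<le> lev \<alpha> (u n)" using lev_mono[OF uT] greater by simp
        ultimately show ?thesis using \<alpha>0(3) by linarith
      qed
      then show ?thesis using \<alpha>\<beta> agree_sym[OF \<alpha>(3)] \<alpha>(4) by (intro exI[of _ \<alpha>]) simp
    qed
  qed
qed

lemma not_Z_bad: assumes t: "t \<in> T" shows "\<not> Z_bad T r rho t"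
proof
  let ?\<beta> = "stop t" let ?l = "lev (stop t) t"
  assume "Z_bad T r rho t"
  then obtain u :: "nat \<Rightarrow> 'a" where u: "inj u" "range u \<subseteq> immediate_successors T r t"
    and conv: "(\<lambda>n. rho (u n)) \<longlonglongrightarrow> rho t" unfolding Z_bad_def by blast
  have tu: "t \<sqsubset> u n" for n using u(2) unfolding immediate_successors_def by blast
  have uT: "u n \<in> T" for n using in_T(2)[OF lt_le[OF tu]] .
  note ev = rho_tendsto_lev_near[OF t tu conv]
  \<comment> \<open>near the exceptional level \<open>2 / a + 1\<close> there are no other levels, and \<open>u n\<close> cannot share it at stage \<open>csuc (stop t)\<close>\<close>
  have small: "?l \<le> 2 / a"
  proof (rule ccontr)
    assume "\<not> ?l \<le> 2 / a"
    then have top: "?l = 2 / a + 1" using lev_small_or_top[OF t, of ?\<beta>] by blast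
    obtain n \<alpha> where \<alpha>: "\<alpha> \<le> ?\<beta>" "agree \<alpha> (u n) t" "lev \<alpha> (u n) \<le> lev \<alpha> t" "?l - 1 / 2 \<le> lev \<alpha> (u n)"
      using eventually_happens'[OF sequentially_bot ev[of "1 / 2"]] by auto
    then have \<alpha>_top: "lev \<alpha> (u n) = 2 / a + 1" using lev_small_or_top[OF uT, of \<alpha> n] top by auto
    then have "lev \<alpha> t = ?l" using \<alpha>(3) lev_mono[OF t \<alpha>(1)] top by simp
    then have "\<alpha> = ?\<beta>" using lev_strict[OF t, of \<alpha> ?\<beta>] \<alpha>(1) by (auto simp: order_le_less)
    then have "agree (csuc ?\<beta>) t (u n)"
      using \<alpha>(2) \<alpha>_top top unfolding agree_csuc by (auto simp: agree_def order_le_less)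
    then have "lev (csuc ?\<beta>) (u n) \<le> 2 / a" using lev_csuc_small[OF tu] by blast
    moreover have "lev \<alpha> (u n) \<le> lev (csuc ?\<beta>) (u n)"
      using \<open>\<alpha> = ?\<beta>\<close> lev_mono[OF uT less_imp_le[OF less_csuc]] by simp
    ultimately show False using \<alpha>_top by simp
  qed
  have near: "N (Y ?\<beta> t ?l) \<le> 1 + a / 2 * ?l + e + b * e" if e: "0 < e" "e \<le> 1" for e
  proof -
    obtain n0 where n0: "\<And>n. n0 \<le> n \<Longrightarrow> \<exists>\<alpha>\<le>?\<beta>. agree \<alpha> (u n) t \<and>
        lev \<alpha> (u n) \<le> lev \<alpha> t \<and> ?l - e \<le> lev \<alpha> (u n)"
      using ev[OF e(1)] unfolding eventually_sequentially by blast
    have "\<exists>f g. f \<in> ext (u (n0 + n)) g \<and> (\<forall>v. v \<sqsubseteq> t \<longrightarrow> \<bar>f v - Y ?\<beta> t ?l v\<bar> \<le> e) \<and>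
        N f < 1 + a / 2 * ?l + e" for n
    proof -
      let ?u = "u (n0 + n)"
      obtain \<alpha> where \<alpha>: "\<alpha> \<le> ?\<beta>" "agree \<alpha> ?u t" "lev \<alpha> ?u \<le> lev \<alpha> t" "?l - e \<le> lev \<alpha> ?u"
        using n0[of "n0 + n"] by auto
      obtain f where f: "f \<in> ext ?u (S \<alpha> ?u (lev \<alpha> ?u))" "N f < 1 + a / 2 * lev \<alpha> ?u + e"
        using lev_feas[OF uT] e(1) unfolding feas_def by blast
      have "a / 2 * lev \<alpha> ?u \<le> a / 2 * ?l"
        using \<alpha>(3) lev_mono[OF t \<alpha>(1)] a_pos by (intro mult_left_mono) auto
      then have "N f < 1 + a / 2 * ?l + e" using f(2) by linarith
      moreover have "\<bar>f v - Y ?\<beta> t ?l v\<bar> \<le> e" if v: "v \<sqsubseteq> t" for v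
      proof -
        have fv: "f v = S \<alpha> t (lev \<alpha> ?u) v"
          using f(1) le_trans[OF v lt_le[OF tu]] S_agree[OF \<alpha>(2)] unfolding ext_def by auto
        show ?thesis
        proof (cases "\<exists>\<eta><\<alpha>. D \<eta> t v")
          case True
          then obtain \<eta> where \<eta>: "\<eta> < \<alpha>" "D \<eta> t v" by blast
          then have "f v = Y ?\<beta> t ?l v"
            using fv S_settled[OF \<eta>] S_settled[of \<eta> ?\<beta> t v] \<alpha>(1) v unfolding Y_def by auto
          then show ?thesis using e(1) by simp
        next
          case False
          then have "f v = lev \<alpha> ?u" using fv S_unsettled[of \<alpha> t v] by auto
          moreover have "lev \<alpha> t \<le> Y ?\<beta> t ?l v \<and> Y ?\<beta> t ?l v \<le> ?l"
            using stair_final_bounds[OF t \<alpha>(1)] False v unfolding Y_def by auto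
          ultimately show ?thesis using \<alpha>(3,4) by auto
        qed
      qed
      ultimately show ?thesis using f(1) by blast
    qed
    then obtain f g where f: "\<And>n. f n \<in> ext (u (n0 + n)) (g n)"
      "\<And>n v. v \<sqsubseteq> t \<Longrightarrow> \<bar>f n v - Y ?\<beta> t ?l v\<bar> \<le> e" "\<And>n. N (f n) < 1 + a / 2 * ?l + e"
      by metis
    have "inj (\<lambda>n. u (n0 + n))" using u(1) unfolding inj_def by (metis add_left_cancel)
    moreover have "range (\<lambda>n. u (n0 + n)) \<subseteq> immediate_successors T r t" using u(2) by blast
    ultimately show ?thesis by (rule average_near[OF t small e _ _ f])
  qed
  have "N (Y ?\<beta> t ?l) \<le> 1 + a / 2 * ?l"
  proof (rule field_le_epsilon)
    fix e :: real assume e: "0 < e"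
    define d where "d = min 1 (e / (1 + b))"
    have d: "0 < d" "d \<le> 1" "d \<le> e / (1 + b)" using e b_pos by (auto simp: d_def)
    then have "d * (1 + b) \<le> e" using pos_le_divide_eq[of "1 + b" d e] b_pos by simp
    then show "N (Y ?\<beta> t ?l) \<le> 1 + a / 2 * ?l + e" using near[OF d(1,2)] by (simp add: algebra_simps)
  qed
  then show False
    using not_attained[OF t lev_stop[OF t] small Y_ext[OF lev_Y_in_V[OF t]]] by simp
qed

end

section \<open>Ever-branching sets\<close>

lemma geometric_limit:
  fixes x :: "nat \<Rightarrow> real"
  assumes "\<And>n. \<bar>x (Suc n) - x n\<bar> \<le> C / 2 ^ n"
  shows "convergent x" "\<bar>lim x - x n\<bar> \<le> 2 * C / 2 ^ n"
proof -
  have tail: "\<bar>x (n + m) - x n\<bar> \<le> 2 * C / 2 ^ n - 2 * C / 2 ^ (n + m)" for n m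
  proof (induction m)
    case (Suc m)
    have "2 * C / 2 ^ (n + m) - C / 2 ^ (n + m) = 2 * C / 2 ^ (n + Suc m)" by (simp add: field_simps)
    then show ?case using Suc assms[of "n + m"] by simp
  qed simp
  have "0 \<le> C" using assms[of 0] by simp
  then have bound: "\<bar>x (n + m) - x n\<bar> \<le> 2 * C / 2 ^ n" for n m
    using tail[of n m] by (smt (verit) divide_nonneg_pos zero_less_power)
  have "(\<lambda>n. 2 * C * (1 / 2) ^ n) \<longlonglongrightarrow> 2 * C * 0" by (intro tendsto_intros LIMSEQ_realpow_zero) auto
  then have "(\<lambda>n. 2 * C / 2 ^ n) \<longlonglongrightarrow> 0" by (simp add: power_divide)
  have "Cauchy x"
  proof (rule CauchyI')
    fix e :: real assume "0 < e"
    then have "\<forall>\<^sub>F n in sequentially. 2 * C / 2 ^ n < e"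
      using order_tendstoD(2)[OF \<open>(\<lambda>n. 2 * C / 2 ^ n) \<longlonglongrightarrow> 0\<close>] by blast
    then obtain M where M: "\<And>n. M \<le> n \<Longrightarrow> 2 * C / 2 ^ n < e" unfolding eventually_sequentially by blast
    have "norm (x m - x n) < e" if "M \<le> m" "m < n" for m n
      using bound[of m "n - m"] M[OF that(1)] that(2) by (simp add: abs_minus_commute)
    then show "\<exists>M. \<forall>m\<ge>M. \<forall>n>m. dist (x m) (x n) < e" by (auto simp: dist_norm)
  qed
  then show conv: "convergent x" by (simp add: Cauchy_convergent_iff)
  have "(\<lambda>m. \<bar>x (m + n) - x n\<bar>) \<longlonglongrightarrow> \<bar>lim x - x n\<bar>"
    using LIMSEQ_ignore_initial_segment[OF conv[unfolded convergent_LIMSEQ_iff], of n] by (intro tendsto_intros)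
  then show "\<bar>lim x - x n\<bar> \<le> 2 * C / 2 ^ n"
    by (rule LIMSEQ_le_const2) (use bound[of n] in \<open>auto simp: add.commute\<close>)
qed

context renormed_tree
begin

lemma not_constant_on_ever_branching:
  assumes E: "ever_branching T r E" shows "\<not> rho constant_on E"
proof
  assume "rho constant_on E"
  then have rho: "rho s = rho t" if "s \<in> E" "t \<in> E" for s t
    using that unfolding constant_on_def by metis
  have ET: "t \<in> T" if "t \<in> E" for t using E that unfolding ever_branching_def by blast
  obtain t0 where t0: "t0 \<in> E" using E unfolding ever_branching_def by blast
  \<comment> \<open>all points of \<open>E\<close> share the last stage \<open>\<beta>\<close>, the last level \<open>l\<close> and the formula \<open>g\<close> for the staircase\<close>
  define \<beta> where "\<beta> = stop t0"
  define l where "l = lev \<beta> t0"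
  define g where "g = S \<beta> t0 l"
  have eq: "lev \<xi> t = lev \<xi> t0" if "t \<in> E" "\<xi> \<le> csuc \<beta>" for t \<xi>
    using rho_eqD(2)[OF ET[OF t0] ET[OF that(1)] rho[OF t0 that(1)], of \<xi>] that(2)
    unfolding \<beta>_def by simp
  have agree: "agree (csuc (csuc \<beta>)) s t" if "s \<in> E" "t \<in> E" for s t
    unfolding agree_csuc using eq[OF that(1)] eq[OF that(2)] by simp
  have g: "S \<beta> t (lev \<beta> t) = g" if t: "t \<in> E" for t
  proof -
    have "lev \<xi> t = lev \<xi> t0" if "\<xi> < \<beta>" for \<xi>
      using eq[OF t, of \<xi>] that less_csuc[of \<beta>] by simp
    then have "agree \<beta> t t0" unfolding agree_def by blast
    then show ?thesis unfolding g_def l_def eq[OF t less_imp_le[OF less_csuc]] by (rule S_agree)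
  qed
  have lev_l: "lev \<beta> t = l" if "t \<in> E" for t
    unfolding l_def using eq[OF that less_imp_le[OF less_csuc]] .
  have "\<exists>u v. u \<in> E \<and> v \<in> E \<and> t \<sqsubset> u \<and> t \<sqsubset> v \<and> \<not> u \<sqsubseteq> v \<and> \<not> v \<sqsubseteq> u" if "t \<in> E" for t
    using E that unfolding ever_branching_def by blast
  then obtain U1 U2 where U: "\<And>t. t \<in> E \<Longrightarrow> U1 t \<in> E \<and> U2 t \<in> E \<and> t \<sqsubset> U1 t \<and> t \<sqsubset> U2 t \<and>
      \<not> U1 t \<sqsubseteq> U2 t \<and> \<not> U2 t \<sqsubseteq> U1 t" by metis
  have small: "l \<le> 2 / a"
  proof -
    have "agree (csuc \<beta>) t0 (U1 t0)"
      using agree[OF t0, of "U1 t0"] U[OF t0] less_csuc[of "csuc \<beta>"] unfolding agree_def by (metis order.strict_trans)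
    then have "lev (csuc \<beta>) (U1 t0) \<le> 2 / a" using lev_csuc_small U[OF t0] by blast
    moreover have "lev \<beta> (U1 t0) \<le> lev (csuc \<beta>) (U1 t0)"
      using U[OF t0] by (intro lev_mono ET less_imp_le[OF less_csuc]) blast
    ultimately show ?thesis using lev_l U[OF t0] by (metis order_trans)
  qed
  \<comment> \<open>Families \<open>h\<close> of functions indexed by \<open>E\<close> are averaged over two incomparable successors. A family is
    admissible if each \<open>h t\<close> extends the staircase of \<open>t\<close>.\<close>
  define \<Phi> :: "('a \<Rightarrow> 'a \<Rightarrow> real) \<Rightarrow> 'a \<Rightarrow> 'a \<Rightarrow> real"
    where "\<Phi> h = (\<lambda>t v. 1 / 2 * (h (U1 t) v + h (U2 t) v))" for h
  define adm :: "('a \<Rightarrow> 'a \<Rightarrow> real) \<Rightarrow> bool" where "adm h \<longleftrightarrow> (\<forall>t\<in>E. h t \<in> ext t g)" for h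
  have adm_\<Phi>: "adm (\<Phi> h)" if h: "adm h" for h
    unfolding adm_def
  proof
    fix t assume t: "t \<in> E"
    have "h (U1 t) \<in> ext t g" "h (U2 t) \<in> ext t g"
      using h U[OF t] ext_mono[OF lt_le] unfolding adm_def by blast+
    then show "\<Phi> h t \<in> ext t g"
      using V_scale[OF V_add[of "h (U1 t)" "h (U2 t)"], of "1 / 2"] unfolding ext_def \<Phi>_def by auto
  qed
  have adm_n: "adm ((\<Phi> ^^ n) h)" if "adm h" for h n
    by (induction n) (use that adm_\<Phi> in auto)
  have N_\<Phi>: "\<forall>t\<in>E. N (\<Phi> h t) \<le> K" if h: "adm h" "\<forall>t\<in>E. N (h t) \<le> K" for h K
  proof
    fix t assume t: "t \<in> E"
    have V: "h (U1 t) \<in> V" "h (U2 t) \<in> V" using h(1) U[OF t] unfolding adm_def ext_def by blast+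
    have "N (\<Phi> h t) = 1 / 2 * N (\<lambda>v. h (U1 t) v + h (U2 t) v)"
      unfolding \<Phi>_def using N_scale[OF V_add[OF V], of "1 / 2"] by simp
    also have "\<dots> \<le> 1 / 2 * (N (h (U1 t)) + N (h (U2 t)))" using N_triangle[OF V] by simp
    also have "\<dots> \<le> K"
    proof -
      have "N (h (U1 t)) \<le> K" "N (h (U2 t)) \<le> K" using h(2) U[OF t] by blast+
      then show ?thesis by simp
    qed
    finally show "N (\<Phi> h t) \<le> K" .
  qed
  have N_n: "\<forall>t\<in>E. N ((\<Phi> ^^ n) h t) \<le> K" if "adm h" "\<forall>t\<in>E. N (h t) \<le> K" for h n K
  proof (induction n)
    case (Suc n)
    show ?case using N_\<Phi>[OF adm_n[OF that(1)] Suc] by simp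
  qed (use that in simp)
  \<comment> \<open>The difference of two extensions for \<open>u\<close> is supported above \<open>u\<close>, so the differences for \<open>U1 t\<close> and
    \<open>U2 t\<close> have disjoint supports and averaging halves the distance.\<close>
  have contract: "\<bar>\<Phi> h t v - \<Phi> k t v\<bar> \<le> M / 2"
    if adm: "adm h" "adm k" and M: "\<And>t v. t \<in> E \<Longrightarrow> \<bar>h t v - k t v\<bar> \<le> M" and t: "t \<in> E" for h k M t v
  proof -
    have above: "u \<sqsubseteq> v" if "u \<in> E" "h u v \<noteq> k u v" for u
    proof (rule ccontr)
      assume "\<not> u \<sqsubseteq> v"
      moreover have "h u \<in> ext u g" "k u \<in> ext u g" using adm that(1) unfolding adm_def by blast+
      ultimately show False using that(2) unfolding ext_def by (cases "v \<sqsubseteq> u") auto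
    qed
    have "h (U1 t) v = k (U1 t) v \<or> h (U2 t) v = k (U2 t) v"
      using above[of "U1 t"] above[of "U2 t"] le_linear[of "U1 t" v "U2 t"] lt_le[of "U2 t" "U1 t"] U[OF t] by blast
    moreover have "\<bar>h (U1 t) v - k (U1 t) v\<bar> \<le> M" "\<bar>h (U2 t) v - k (U2 t) v\<bar> \<le> M" using M U[OF t] by blast+
    moreover have eq: "\<Phi> h t v - \<Phi> k t v = ((h (U1 t) v - k (U1 t) v) + (h (U2 t) v - k (U2 t) v)) / 2"
      unfolding \<Phi>_def by (simp add: field_simps)
    moreover have "\<bar>(p + q) / 2\<bar> \<le> M / 2" if "p = 0 \<or> q = 0" "\<bar>p\<bar> \<le> M" "\<bar>q\<bar> \<le> M" for p q :: real
      using that by auto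
    ultimately show ?thesis unfolding eq by simp
  qed
  have contract_n: "\<forall>t\<in>E. \<forall>v. \<bar>(\<Phi> ^^ n) h t v - (\<Phi> ^^ n) k t v\<bar> \<le> M / 2 ^ n"
    if adm: "adm h" "adm k" and M: "\<And>t v. t \<in> E \<Longrightarrow> \<bar>h t v - k t v\<bar> \<le> M" for h k M n
  proof (induction n)
    case (Suc n)
    have "\<bar>\<Phi> ((\<Phi> ^^ n) h) t v - \<Phi> ((\<Phi> ^^ n) k) t v\<bar> \<le> (M / 2 ^ n) / 2" if "t \<in> E" for t v
      by (rule contract[OF adm_n[OF adm(1)] adm_n[OF adm(2)] _ that]) (use Suc in blast)
    moreover have "M / 2 ^ n / 2 = M / 2 ^ Suc n" by simp
    ultimately show ?case unfolding funpow.simps o_apply by metis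
  qed (use M in simp)
  have near_opt: "\<exists>A. adm A \<and> (\<forall>t\<in>E. N (A t) \<le> 1 + a / 2 * l + e) \<and> (\<forall>t\<in>E. \<forall>v. \<bar>A t v\<bar> \<le> 3 / a)"
    if e: "0 < e" "e \<le> 1" for e
  proof -
    have "\<exists>f. f \<in> ext t g \<and> N f < 1 + a / 2 * l + e" if t: "t \<in> E" for t
    proof -
      have "feas t g (1 + a / 2 * l)"
        using lev_feas[OF ET[OF t], of \<beta>] unfolding lev_l[OF t] g[OF t, unfolded lev_l[OF t]] .
      then show ?thesis using e(1) unfolding feas_def by blast
    qed
    then obtain A where A: "\<And>t. t \<in> E \<Longrightarrow> A t \<in> ext t g \<and> N (A t) < 1 + a / 2 * l + e" by metis
    have "\<bar>A t v\<bar> \<le> 3 / a" if "t \<in> E" for t v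
      using near_optimal_bound[of "A t" t g l e v] A[OF that] small e(2) by blast
    moreover have "N (A t) \<le> 1 + a / 2 * l + e" if "t \<in> E" for t using A[OF that] by simp
    ultimately show ?thesis using A unfolding adm_def by (intro exI[of _ A]) simp
  qed
  \<comment> \<open>the averages of the staircases themselves converge to \<open>F\<close>\<close>
  define B where "B = (\<lambda>t. Y \<beta> t l)"
  have admB: "adm B"
    unfolding adm_def B_def
  proof
    fix t assume t: "t \<in> E"
    show "Y \<beta> t l \<in> ext t g"
      using Y_ext[OF lev_Y_in_V[OF ET[OF t]], of \<beta>]
      unfolding lev_l[OF t] g[OF t, unfolded lev_l[OF t]] .
  qed
  have B: "\<bar>B t v\<bar> \<le> 3 / a" if t: "t \<in> E" for t v
  proof -
    obtain A where A: "adm A" "\<forall>t\<in>E. \<forall>v. \<bar>A t v\<bar> \<le> 3 / a"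
      using near_opt[OF zero_less_one order_refl] by blast
    have "B t \<in> ext t g" "A t \<in> ext t g" using admB A(1) t unfolding adm_def by blast+
    then have "v \<sqsubseteq> t \<Longrightarrow> B t v = A t v" unfolding ext_def by simp
    moreover have "\<not> v \<sqsubseteq> t \<Longrightarrow> B t v = 0" unfolding B_def Y_def by simp
    moreover have "\<bar>A t v\<bar> \<le> 3 / a" "0 < 3 / a" using A(2) t a_pos by simp_all
    ultimately show ?thesis by (cases "v \<sqsubseteq> t") simp_all
  qed
  define x where "x = (\<lambda>v n. (\<Phi> ^^ n) B t0 v)"
  have step: "\<bar>x v (Suc n) - x v n\<bar> \<le> (6 / a) / 2 ^ n" for v n
  proof -
    have "\<bar>\<Phi> B t v - B t v\<bar> \<le> 6 / a" if "t \<in> E" for t v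
    proof -
      have "\<bar>B (U1 t) v\<bar> \<le> 3 / a" "\<bar>B (U2 t) v\<bar> \<le> 3 / a" "\<bar>B t v\<bar> \<le> 3 / a" using B U[OF that] that by blast+
      moreover have "\<bar>1 / 2 * (p + q) - w\<bar> \<le> 2 * c" if "\<bar>p\<bar> \<le> c" "\<bar>q\<bar> \<le> c" "\<bar>w\<bar> \<le> c" for p q w c :: real
      proof -
        have "p \<le> c" "- p \<le> c" "q \<le> c" "- q \<le> c" "w \<le> c" "- w \<le> c"
          using that unfolding abs_le_iff by blast+
        then show ?thesis by (intro abs_leI) argo+
      qed
      ultimately have "\<bar>\<Phi> B t v - B t v\<bar> \<le> 2 * (3 / a)" unfolding \<Phi>_def by blast
      then show ?thesis by simp
    qed
    then show ?thesis
      unfolding x_def funpow_Suc_right o_apply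
      using contract_n[OF adm_\<Phi>[OF admB] admB, of "6 / a" n] t0 by blast
  qed
  define F where "F = (\<lambda>v. lim (x v))"
  have F: "\<bar>F v - x v n\<bar> \<le> 2 * (6 / a) / 2 ^ n" for v n
    unfolding F_def using step by (rule geometric_limit(2))
  have small_n: "\<exists>n. C / 2 ^ n < e" if "0 < e" for C e :: real
  proof -
    have "(\<lambda>n. C * (1 / 2) ^ n) \<longlonglongrightarrow> C * 0" by (intro tendsto_intros LIMSEQ_realpow_zero) auto
    then have "(\<lambda>n. C / 2 ^ n) \<longlonglongrightarrow> 0" by (simp add: power_divide)
    then have "\<forall>\<^sub>F n in sequentially. C / 2 ^ n < e" using that by (rule order_tendstoD(2))
    then show ?thesis by (rule eventually_happens'[OF sequentially_bot])
  qed
  have xV: "(\<lambda>v. x v n) \<in> ext t0 g" for n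
  proof -
    have "(\<Phi> ^^ n) B t0 \<in> ext t0 g" using adm_n[OF admB, of n] t0 unfolding adm_def by blast
    then show ?thesis unfolding x_def .
  qed
  have FV: "F \<in> V"
  proof (rule V_uniform_limit)
    fix e :: real assume "0 < e"
    then obtain n where n: "2 * (6 / a) / 2 ^ n < e" using small_n[of e "2 * (6 / a)"] by blast
    have "\<bar>F v - x v n\<bar> \<le> e" for v using F[of v n] n by linarith
    then show "\<exists>g\<in>V. \<forall>v. \<bar>F v - g v\<bar> \<le> e" 
      using xV[of n] unfolding ext_def by (intro bexI[of _ "\<lambda>v. x v n"]) auto
  qed
  have F_ext: "F \<in> ext t0 g"
  proof -
    have F_const: "F v = c" if "\<And>n. x v n = c" for v c
    proof -
      have "x v = (\<lambda>n. c)" using that by blast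
      then show ?thesis unfolding F_def by simp
    qed
    have "F v = g v" if "v \<sqsubseteq> t0" for v
      by (rule F_const) (use xV that in \<open>simp add: ext_def\<close>)
    moreover have "F v = 0" if "\<not> v \<sqsubseteq> t0 \<and> \<not> t0 \<sqsubseteq> v" for v
      by (rule F_const) (use xV that in \<open>simp add: ext_def\<close>)
    ultimately show ?thesis using FV unfolding ext_def by blast
  qed
  \<comment> \<open>the averages of nearly optimal extensions \<open>A\<close> have the same limit \<open>F\<close>, and are as nearly optimal as \<open>A\<close>\<close>
  have NF: "N F \<le> 1 + a / 2 * l + e" if e: "0 < e" for e
  proof -
    define d where "d = min 1 (e / 2)"
    have d: "0 < d" "d \<le> 1" "d \<le> e / 2" using e by (auto simp: d_def)
    obtain A where A: "adm A" "\<forall>t\<in>E. N (A t) \<le> 1 + a / 2 * l + d" "\<forall>t\<in>E. \<forall>v. \<bar>A t v\<bar> \<le> 3 / a"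
      using near_opt[OF d(1,2)] by blast
    have e': "0 < e / (2 * b)" using e b_pos by simp
    obtain n where n: "(18 / a) / 2 ^ n < e / (2 * b)" using small_n[OF e', of "18 / a"] by blast
    have AV: "(\<Phi> ^^ n) A t0 \<in> V" using adm_n[OF A(1)] t0 unfolding adm_def ext_def by blast
    have AB: "\<bar>B t v - A t v\<bar> \<le> 6 / a" if "t \<in> E" for t v
    proof -
      have "\<bar>B t v\<bar> \<le> 3 / a" "\<bar>A t v\<bar> \<le> 3 / a" using B A(3) that by blast+
      moreover have "\<bar>p - q\<bar> \<le> 2 * c" if "\<bar>p\<bar> \<le> c" "\<bar>q\<bar> \<le> c" for p q c :: real
        using that by linarith
      ultimately have "\<bar>B t v - A t v\<bar> \<le> 2 * (3 / a)" by blast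
      then show ?thesis by simp
    qed
    have "\<bar>F v - (\<Phi> ^^ n) A t0 v\<bar> \<le> (18 / a) / 2 ^ n" for v
    proof -
      have "\<bar>x v n - (\<Phi> ^^ n) A t0 v\<bar> \<le> (6 / a) / 2 ^ n"
        unfolding x_def using contract_n[OF admB A(1) AB] t0 by blast
      moreover have "2 * (6 / a) / 2 ^ n + (6 / a) / 2 ^ n = (18 / a) / 2 ^ n" by (simp add: field_simps)
      ultimately show ?thesis using F[of v n] by linarith
    qed
    then have "N F \<le> N ((\<Phi> ^^ n) A t0) + b * ((18 / a) / 2 ^ n)" by (rule N_near[OF FV AV])
    moreover have "b * ((18 / a) / 2 ^ n) \<le> e / 2"
    proof -
      have "b * ((18 / a) / 2 ^ n) \<le> b * (e / (2 * b))" using n b_pos by (intro mult_left_mono) auto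
      then show ?thesis using b_pos by simp
    qed
    moreover have "N ((\<Phi> ^^ n) A t0) \<le> 1 + a / 2 * l + d" using N_n[OF A(1,2)] t0 by blast
    ultimately show ?thesis using d(3) by linarith
  qed
  then have "N F \<le> 1 + a / 2 * l" by (rule field_le_epsilon)
  moreover have "1 + a / 2 * l < N F"
    using not_attained[OF ET[OF t0] lev_stop[OF ET[OF t0]], of F] small F_ext
    unfolding g_def l_def \<beta>_def by blast
  ultimately show False by simp
qed

end

theorem theorem12:
  fixes T :: "'a set" and r :: "'a rel"
  assumes "tree T r"
    and "\<exists>N. equivalent_norm_on (C0 (interval_topology T r)) N \<and>
             Gateaux_smooth_on (C0 (interval_topology T r)) N"
  shows "\<exists>\<rho> :: 'a \<Rightarrow> Z.
           increasing_on T r \<rho> \<and>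
           (\<forall>t\<in>T. \<not> Z_bad T r \<rho> t) \<and>
           (\<forall>E. ever_branching T r E \<longrightarrow> \<not> \<rho> constant_on E)"
proof -
  obtain N where N: "equivalent_norm_on (C0 (interval_topology T r)) N"
    "Gateaux_smooth_on (C0 (interval_topology T r)) N" using assms(2) by blast
  obtain a b where ab: "a > 0" "b > 0"
    "\<forall>f\<in>C0 (interval_topology T r). a * sup_norm f \<le> N f \<and> N f \<le> b * sup_norm f"
    using N(1) unfolding equivalent_norm_on_def by blast
  interpret renormed_tree T r N a b
  proof unfold_locales
    show "tree T r" by (rule assms(1))
    show "Gateaux_smooth_on (C0 (interval_topology T r)) N" by (rule N(2))
  qed (use N(1) ab in \<open>simp_all add: equivalent_norm_on_def\<close>)
  show ?thesis
    using rho_increasing not_Z_bad not_constant_on_ever_branching by blast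
qed

end
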